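(* Let $M>0$, $H\in\mathbb{R}$, $c_1=-8M^3H$ and $\bar c_1\in\mathbb{R}$, and let $\Sigma^1=\Sigma^1_{H,c_1,\bar c_1}$ be the corresponding SS-CMC hypersurface in region I. Then there is $\bar c_3\in\mathbb{R}$ such that $\Sigma^1$ connects with the SS-CMC hypersurface $\Sigma^3=\Sigma^3_{H,c_1,\bar c_3}$ in region I$'$, in such a way that $\Sigma^1\cup\Sigma^3$ forms a complete and smooth SS-CMC hypersurface in the Kruskal extension with two ends.
   Context: Kruskal extension: for $M>0$ and $h(r)=1-\frac{2M}{r}$, it is the manifold $\{(U,V)\in\mathbb{R}^2: UV>-2M\}\times\mathbb{S}^2$ with metric $\mathrm{d}s^2=\frac{16M^2e^{-r/2M}}{r}\,\mathrm{d}U\,\mathrm{d}V+r^2(\mathrm{d}\theta^2+\sin^2\theta\,\mathrm{d}\phi^2)$, where $r>0$ is determined by $(r-2M)e^{r/2M}=UV$. With $X=\frac{V+U}2$, $T=\frac{V-U}2$ one has $\mathrm{d}U\,\mathrm{d}V=-\mathrm{d}T^2+\mathrm{d}X^2$, and $\partial_T$ is taken to be future directed. Regions: I $=\{U>0,V>0\}$, I$'=\{U<0,V<0\}$. In each of these one uses coordinates $(t,r,\theta,\phi)$, $r>2M$, with $t=2M\ln|V/U|$; equivalently, with $u=t-(r+2M\ln|r-2M|)$, $v=t+(r+2M\ln|r-2M|)$, one has $|U|=e^{-u/4M}$, $|V|=e^{v/4M}$. In these coordinates $\mathrm{d}s^2=-h\,\mathrm{d}t^2+h^{-1}\mathrm{d}r^2+r^2(\mathrm{d}\theta^2+\sin^2\theta\,\mathrm{d}\phi^2)$.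 The future direction is increasing $t$ in I and decreasing $t$ in I$'$. SS-CMC means spacelike, spherically symmetric, with constant mean curvature. The mean curvature is $H=\frac13\sum_i\langle\nabla_{e_i}N,e_i\rangle$, where $N$ is the future directed unit timelike normal and $\{e_i\}$ is an orthonormal tangent frame. $\Sigma^1_{H,c,\bar c}$ is the hypersurface $t=f_1(r)$, $r>2M$, in region I with $f_1(r)=\int_{r_1}^r\frac{l_1(x)}{h(x)}\frac{\mathrm{d}x}{\sqrt{1+l_1(x)^2}}+\bar c$, $l_1(r)=\frac1{\sqrt{h(r)}}\left(Hr+\frac{c}{r^2}\right)$, where $r_1>2M$ is fixed. $\Sigma^3_{H,c,\bar c}$ is the hypersurface $t=f_3(r)$, $r>2M$, in region I$'$ with $f_3(r)=\int_{r_3}^r\frac{l_3(x)}{h(x)}\frac{\mathrm{d}x}{\sqrt{1+l_3(x)^2}}+\bar c$, $l_3=-l_1$, where $r_3>2M$ is fixed. The union $\Sigma^1\cup\Sigma^3$ is understood to include the limiting sphere $U=V=0$ (where $r=2M$). A hypersurface is complete if it has no boundary and is a closed subset of the spacetime. *)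

theory Defs
  imports "HOL-Analysis.Analysis"
begin


text \<open>
  A spacetime is given by a subset \<open>K\<close> of a Euclidean space \<open>'a\<close> that is an embedded
  submanifold, by a symmetric bilinear form \<open>g p\<close> on \<open>'a\<close> depending smoothly on \<open>p\<close> in a
  neighbourhood of \<open>K\<close>, whose restriction to the tangent spaces of \<open>K\<close> is the Lorentzian metric,
  and by a timelike vector field \<open>\<tau>\<close> on \<open>K\<close> fixing the time orientation.
\<close>

primrec Ck_on :: "nat \<Rightarrow> 'a::euclidean_space set \<Rightarrow> ('a \<Rightarrow> 'b::real_normed_vector) \<Rightarrow> bool" where
  "Ck_on 0 W F \<longleftrightarrow> continuous_on W F"
| "Ck_on (Suc k) W F \<longleftrightarrow>
     (\<forall>p\<in>W. F differentiable (at p)) \<and> (\<forall>v. Ck_on k W (\<lambda>p. frechet_derivative F (at p) v))"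

definition smooth_on :: "'a::euclidean_space set \<Rightarrow> ('a \<Rightarrow> 'b::real_normed_vector) \<Rightarrow> bool" where
  "smooth_on W F \<longleftrightarrow> (\<forall>k. Ck_on k W F)"

text \<open>
  Velocities at \<open>p\<close> of curves in \<open>S\<close>. For an embedded submanifold \<open>S\<close> these form the usual tangent
  space, whether or not the curves are required to be smooth away from time \<open>0\<close>.
\<close>

definition tangent_space :: "'a::euclidean_space set \<Rightarrow> 'a \<Rightarrow> 'a set" where
  "tangent_space S p =
     {v. \<exists>\<gamma>. (\<forall>s::real. \<gamma> s \<in> S) \<and> \<gamma> 0 = p \<and> (\<gamma> has_vector_derivative v) (at 0)}"

text \<open>
  Embedded hypersurface: near each of its points it is a regular level set of a smooth function on
  \<open>K\<close>. In particular it has no boundary points.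
\<close>

definition smooth_hypersurface :: "'a::euclidean_space set \<Rightarrow> 'a set \<Rightarrow> bool" where
  "smooth_hypersurface K S \<longleftrightarrow> S \<subseteq> K \<and>
     (\<forall>p\<in>S. \<exists>W (F :: 'a \<Rightarrow> real). open W \<and> p \<in> W \<and> smooth_on W F \<and>
        S \<inter> W = {q \<in> K \<inter> W. F q = 0} \<and>
        (\<forall>q\<in>S \<inter> W. \<exists>v\<in>tangent_space K q. frechet_derivative F (at q) v \<noteq> 0))"

definition complete_hypersurface :: "'a::euclidean_space set \<Rightarrow> 'a set \<Rightarrow> bool" where
  "complete_hypersurface K S \<longleftrightarrow> smooth_hypersurface K S \<and> closedin (top_of_set K) S"

text \<open>
  The Levi-Civita connection of \<open>(K, g)\<close>. By the Koszul formula the Levi-Civita connection of the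
  ambient metric satisfies \<open>g(\<nabla>\<^sub>x Y, z) =\<close> \<open>koszul_form g p x Y z\<close>; the induced connection on \<open>K\<close> is
  its tangential projection. Only the derivative of \<open>Y\<close> in the direction \<open>x\<close> enters, so for \<open>x\<close>
  tangent to a submanifold the values of \<open>Y\<close> off that submanifold are irrelevant.
\<close>

definition metric_deriv ::
  "('a::euclidean_space \<Rightarrow> 'a \<Rightarrow> 'a \<Rightarrow> real) \<Rightarrow> 'a \<Rightarrow> 'a \<Rightarrow> 'a \<Rightarrow> 'a \<Rightarrow> real" where
  "metric_deriv g p x y z = frechet_derivative (\<lambda>q. g q y z) (at p) x"

definition koszul_form ::
  "('a::euclidean_space \<Rightarrow> 'a \<Rightarrow> 'a \<Rightarrow> real) \<Rightarrow> 'a \<Rightarrow> 'a \<Rightarrow> ('a \<Rightarrow> 'a) \<Rightarrow> 'a \<Rightarrow> real" where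
  "koszul_form g p x Y z = g p (frechet_derivative Y (at p) x) z +
     (metric_deriv g p x (Y p) z + metric_deriv g p (Y p) x z - metric_deriv g p z x (Y p)) / 2"

lemma koszul_form_metric_compatible:
  assumes "\<And>q y z. g q y z = g q z y"
  shows "koszul_form g p x Y (Z p) + koszul_form g p x Z (Y p) =
    metric_deriv g p x (Y p) (Z p) +
    g p (frechet_derivative Y (at p) x) (Z p) + g p (Y p) (frechet_derivative Z (at p) x)"
proof -
  have "metric_deriv g p a b c = metric_deriv g p a c b" for a b c
    using assms[of _ b c] by (simp add: metric_deriv_def)
  then show ?thesis
    using assms by (simp add: koszul_form_def field_simps)
qed

lemma koszul_form_torsion_free:
  assumes "\<And>q y z. g q y z = g q z y" "\<And>z. linear (\<lambda>y. g p y z)"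
  shows "koszul_form g p (X p) Y z - koszul_form g p (Y p) X z =
    g p (frechet_derivative Y (at p) (X p) - frechet_derivative X (at p) (Y p)) z"
proof -
  have "metric_deriv g p a b c = metric_deriv g p a c b" for a b c
    using assms(1)[of _ b c] by (simp add: metric_deriv_def)
  then have "metric_deriv g p z (X p) (Y p) = metric_deriv g p z (Y p) (X p)" by blast
  then show ?thesis
    by (simp add: koszul_form_def linear_diff[OF assms(2)])
qed

definition levi_civita ::
  "'a::euclidean_space set \<Rightarrow> ('a \<Rightarrow> 'a \<Rightarrow> 'a \<Rightarrow> real) \<Rightarrow> 'a \<Rightarrow> 'a \<Rightarrow> ('a \<Rightarrow> 'a) \<Rightarrow> 'a" where
  "levi_civita K g p x Y =
     (THE w. w \<in> tangent_space K p \<and> (\<forall>z\<in>tangent_space K p. g p w z = koszul_form g p x Y z))"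

definition spacelike :: "('a::euclidean_space \<Rightarrow> 'a \<Rightarrow> 'a \<Rightarrow> real) \<Rightarrow> 'a set \<Rightarrow> bool" where
  "spacelike g S \<longleftrightarrow> (\<forall>p\<in>S. \<forall>v\<in>tangent_space S p. v \<noteq> 0 \<longrightarrow> g p v v > 0)"

definition future_unit_normal ::
  "'a::euclidean_space set \<Rightarrow> ('a \<Rightarrow> 'a \<Rightarrow> 'a \<Rightarrow> real) \<Rightarrow> ('a \<Rightarrow> 'a) \<Rightarrow> 'a set \<Rightarrow> 'a \<Rightarrow> 'a \<Rightarrow> bool" where
  "future_unit_normal K g \<tau> S p n \<longleftrightarrow> n \<in> tangent_space K p \<and>
     (\<forall>v\<in>tangent_space S p. g p n v = 0) \<and> g p n n = -1 \<and> g p n (\<tau> p) < 0"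

definition orthonormal_frame ::
  "('a::euclidean_space \<Rightarrow> 'a \<Rightarrow> 'a \<Rightarrow> real) \<Rightarrow> 'a set \<Rightarrow> 'a \<Rightarrow> (nat \<Rightarrow> 'a) \<Rightarrow> bool" where
  "orthonormal_frame g S p e \<longleftrightarrow> (\<forall>i\<in>{1..3}. e i \<in> tangent_space S p) \<and>
     (\<forall>i\<in>{1..3}. \<forall>j\<in>{1..3}. g p (e i) (e j) = (if i = j then 1 else 0))"

text \<open>
  Mean curvature of a three-dimensional hypersurface. The unit normal field is determined along \<open>S\<close>;
  \<open>N\<close> is any differentiable extension of it.
\<close>

definition has_mean_curvature ::
  "'a::euclidean_space set \<Rightarrow> ('a \<Rightarrow> 'a \<Rightarrow> 'a \<Rightarrow> real) \<Rightarrow> ('a \<Rightarrow> 'a) \<Rightarrow> 'a set \<Rightarrow> 'a \<Rightarrow> real \<Rightarrow> bool" where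
  "has_mean_curvature K g \<tau> S p H \<longleftrightarrow>
     (\<exists>W N. open W \<and> p \<in> W \<and> (\<forall>q\<in>S \<inter> W. future_unit_normal K g \<tau> S q (N q)) \<and>
        N differentiable (at p) \<and>
        (\<forall>e. orthonormal_frame g S p e \<longrightarrow>
           1 / 3 * (\<Sum>i=1..3. g p (levi_civita K g p (e i) N) (e i)) = H))"

text \<open>
  The space of ends: the inverse limit of the components of the complements of compact subsets.
\<close>

definition topological_ends :: "'a::topological_space set \<Rightarrow> ('a set \<Rightarrow> 'a set) set" where
  "topological_ends S =
     {\<epsilon> \<in> (\<Pi>\<^sub>E C\<in>{C. compact C \<and> C \<subseteq> S}. components (S - C)).
        \<forall>C D. compact C \<and> compact D \<and> C \<subseteq> D \<and> D \<subseteq> S \<longrightarrow> \<epsilon> D \<subseteq> \<epsilon> C}"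



text \<open>
  Points are triples \<open>(U, V, \<omega>)\<close> with \<open>\<omega>\<close> on the unit sphere of \<open>\<real>\<^sup>3\<close>.
\<close>

type_synonym event = "real \<times> real \<times> (real ^ 3)"

definition kruskal :: "real \<Rightarrow> event set" where
  "kruskal M = {(U, V, \<omega>). U * V > - 2 * M \<and> norm \<omega> = 1}"

definition radius :: "real \<Rightarrow> real \<Rightarrow> real \<Rightarrow> real" where
  "radius M U V = (THE r. r > 0 \<and> (r - 2 * M) * exp (r / (2 * M)) = U * V)"

text \<open>
  The symmetric product \<open>dU dV\<close> is \<open>(dU \<otimes> dV + dV \<otimes> dU) / 2\<close>, and the round metric is the
  restriction of the Euclidean inner product of \<open>\<real>\<^sup>3\<close>.
\<close>

definition kruskal_metric :: "real \<Rightarrow> event \<Rightarrow> event \<Rightarrow> event \<Rightarrow> real" where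
  "kruskal_metric M = (\<lambda>(U, V, \<omega>) (a, b, w) (a', b', w').
     (let r = radius M U V in
        16 * M\<^sup>2 * exp (- r / (2 * M)) / r * ((a * b' + b * a') / 2) + r\<^sup>2 * (w \<bullet> w')))"

text \<open>\<open>\<partial>\<^sub>T = \<partial>\<^sub>V - \<partial>\<^sub>U\<close>, as \<open>U = X - T\<close> and \<open>V = X + T\<close>.\<close>

definition kruskal_dT :: "event \<Rightarrow> event" where
  "kruskal_dT p = (-1, 1, 0)"

definition spherically_symmetric :: "event set \<Rightarrow> bool" where
  "spherically_symmetric S \<longleftrightarrow>
     (\<forall>A. rotation_matrix A \<longrightarrow> (\<forall>U V \<omega>. (U, V, \<omega>) \<in> S \<longrightarrow> (U, V, A *v \<omega>) \<in> S))"

definition ss_cmc :: "real \<Rightarrow> real \<Rightarrow> event set \<Rightarrow> bool" where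
  "ss_cmc M H S \<longleftrightarrow> smooth_hypersurface (kruskal M) S \<and> spacelike (kruskal_metric M) S \<and>
     spherically_symmetric S \<and>
     (\<forall>p\<in>S. has_mean_curvature (kruskal M) (kruskal_metric M) kruskal_dT S p H)"

definition schwarzschild_h :: "real \<Rightarrow> real \<Rightarrow> real" where
  "schwarzschild_h M r = 1 - 2 * M / r"

definition schwarzschild_t :: "real \<Rightarrow> real \<Rightarrow> real \<Rightarrow> real" where
  "schwarzschild_t M U V = 2 * M * ln \<bar>V / U\<bar>"

definition l1 :: "real \<Rightarrow> real \<Rightarrow> real \<Rightarrow> real \<Rightarrow> real" where
  "l1 M H c r = 1 / sqrt (schwarzschild_h M r) * (H * r + c / r\<^sup>2)"

definition l3 :: "real \<Rightarrow> real \<Rightarrow> real \<Rightarrow> real \<Rightarrow> real" where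
  "l3 M H c r = - l1 M H c r"

definition height :: "real \<Rightarrow> (real \<Rightarrow> real) \<Rightarrow> real \<Rightarrow> real \<Rightarrow> real \<Rightarrow> real" where
  "height M l r\<^sub>0 cbar r =
     (LBINT x=ereal r\<^sub>0..ereal r. l x / schwarzschild_h M x * (1 / sqrt (1 + (l x)\<^sup>2))) + cbar"

definition Sigma1 :: "real \<Rightarrow> real \<Rightarrow> real \<Rightarrow> real \<Rightarrow> real \<Rightarrow> event set" where
  "Sigma1 M H c r\<^sub>1 cbar = {(U, V, \<omega>). (U, V, \<omega>) \<in> kruskal M \<and> U > 0 \<and> V > 0 \<and>
     schwarzschild_t M U V = height M (l1 M H c) r\<^sub>1 cbar (radius M U V)}"

definition Sigma3 :: "real \<Rightarrow> real \<Rightarrow> real \<Rightarrow> real \<Rightarrow> real \<Rightarrow> event set" where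
  "Sigma3 M H c r\<^sub>3 cbar = {(U, V, \<omega>). (U, V, \<omega>) \<in> kruskal M \<and> U < 0 \<and> V < 0 \<and>
     schwarzschild_t M U V = height M (l3 M H c) r\<^sub>3 cbar (radius M U V)}"

definition bifurcation_sphere :: "real \<Rightarrow> event set" where
  "bifurcation_sphere M = {(U, V, \<omega>). (U, V, \<omega>) \<in> kruskal M \<and> U = 0 \<and> V = 0}"

end

theory Submission
  imports Defs
begin

text \<open>The value \<open>c = -8M^3H\<close> is the one for which Hr + c/r^2 = H(r^3 - 8M^3)/r^2
  vanishes at r = 2M. Then dt/dr grows at most like (r - 2M)^(-1/2), so t has a finite limit at the
  horizon and U, V tend to 0 together, at a finite ratio. Since UV = s^2 exp(r/2M), both have a
  simple zero in \<open>s\<close>, and the curve crosses from I to I'. Evenness of dt/ds matches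
  \<open>l3 = -l1\<close>: reversing s reverses dt/dr and leaves dt/ds alone. So one antiderivative
  serves both regions; \<open>cbar\<^sub>1\<close> fixes its constant, and
  \<open>cbar\<^sub>3\<close> is read off from it. The surface and its normal are built from
  functions of one real variable, and \<open>radius\<close> enters only through first derivatives of
  the metric. No higher regularity of r across the horizon has to be established.\<close>

text \<open>
  In the parameter \<open>s\<close> with \<open>s\<^sup>2 = r - 2M\<close>, taken positive in region I and negative in region I',
  the choice \<open>c = -8M\<^sup>3H\<close> makes \<open>dt/ds\<close> an even smooth function of \<open>s\<close>. If \<open>F\<close> is an antiderivative of
  it, \<open>U = s exp ((r - F)/4M)\<close>, \<open>V = s exp ((r + F)/4M)\<close> is a smooth spacelike curve through
  \<open>U = V = 0\<close>: its part \<open>s > 0\<close> is \<open>\<Sigma>\<^sup>1\<close>, its part \<open>s < 0\<close> is \<open>\<Sigma>\<^sup>3\<close> for the constant given by \<open>F\<close>.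
  Since \<open>dX/ds > 0\<close> and \<open>X\<close> maps onto the line, the curve is the graph \<open>T = \<phi>(X)\<close> of a smooth function
  on the whole line, so the hypersurface is closed, regular and diffeomorphic to \<open>\<real> \<times> S\<^sup>2\<close>. The mean
  curvature is computed in the unit normal that depends on \<open>X\<close> only: the angular principal
  curvatures are \<open>H - 8HM\<^sup>3/r\<^sup>3\<close>, and the radial one is \<open>H + 16HM\<^sup>3/r\<^sup>3\<close>.
\<close>

section \<open>Smooth functions on Euclidean spaces\<close>

lemma Ck_on_SucI:
  assumes "\<And>p. (F has_derivative F' p) (at p)" and "\<And>v. Ck_on k UNIV (\<lambda>p. F' p v)"
  shows "Ck_on (Suc k) UNIV F"
proof -
  have "frechet_derivative F (at p) = F' p" for p
    using frechet_derivative_at[OF assms(1)] by simp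
  with assms show ?thesis
    by (auto simp: differentiable_def)
qed

lemma Ck_on_SucE:
  assumes "Ck_on (Suc k) UNIV F"
  obtains F' where "\<And>p. (F has_derivative F' p) (at p)" and "\<And>v. Ck_on k UNIV (\<lambda>p. F' p v)"
  using assms that[of "\<lambda>p. frechet_derivative F (at p)"] frechet_derivative_works by auto

lemma Ck_on_pred: "Ck_on (Suc k) UNIV F \<Longrightarrow> Ck_on k UNIV F"
proof (induction k arbitrary: F)
  case 0
  then show ?case
    by (auto intro!: continuous_at_imp_continuous_on differentiable_imp_continuous_within)
next
  case (Suc k)
  then show ?case by (meson Ck_on.simps(2))
qed

lemma Ck_on_const: "Ck_on k UNIV (\<lambda>p. c)"
proof (induction k arbitrary: c)
  case (Suc k)
  show ?case by (rule Ck_on_SucI[where F' = "\<lambda>p v. 0"]) (auto intro: Suc)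
qed auto

lemma Ck_on_bounded_linear:
  assumes "bounded_linear L"
  shows "Ck_on k UNIV L"
proof (cases k)
  case 0
  then show ?thesis using assms by (auto intro: linear_continuous_on)
next
  case (Suc k)
  then show ?thesis
    using Ck_on_SucI[of L "\<lambda>p. L" k] bounded_linear_imp_has_derivative[OF assms] Ck_on_const by blast
qed

lemma Ck_on_add: "Ck_on k UNIV f \<Longrightarrow> Ck_on k UNIV g \<Longrightarrow> Ck_on k UNIV (\<lambda>p. f p + g p)"
proof (induction k arbitrary: f g)
  case 0
  then show ?case by (auto intro: continuous_intros)
next
  case (Suc k)
  obtain f' where f: "\<And>p. (f has_derivative f' p) (at p)" "\<And>v. Ck_on k UNIV (\<lambda>p. f' p v)"
    using Ck_on_SucE[OF Suc.prems(1)] by blast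
  obtain g' where g: "\<And>p. (g has_derivative g' p) (at p)" "\<And>v. Ck_on k UNIV (\<lambda>p. g' p v)"
    using Ck_on_SucE[OF Suc.prems(2)] by blast
  show ?case
    by (rule Ck_on_SucI[OF has_derivative_add[OF f(1) g(1)]]) (use f g Suc.IH in blast)
qed

lemma Ck_on_mult:
  fixes f g :: "'a::euclidean_space \<Rightarrow> real"
  shows "Ck_on k UNIV f \<Longrightarrow> Ck_on k UNIV g \<Longrightarrow> Ck_on k UNIV (\<lambda>p. f p * g p)"
proof (induction k arbitrary: f g)
  case 0
  then show ?case by (auto intro: continuous_intros)
next
  case (Suc k)
  obtain f' where f: "\<And>p. (f has_derivative f' p) (at p)" "\<And>v. Ck_on k UNIV (\<lambda>p. f' p v)"
    using Ck_on_SucE[OF Suc.prems(1)] by blast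
  obtain g' where g: "\<And>p. (g has_derivative g' p) (at p)" "\<And>v. Ck_on k UNIV (\<lambda>p. g' p v)"
    using Ck_on_SucE[OF Suc.prems(2)] by blast
  show ?case
    by (rule Ck_on_SucI[OF has_derivative_mult[OF f(1) g(1)]])
      (intro Ck_on_add Suc.IH f g Ck_on_pred[OF Suc.prems(1)] Ck_on_pred[OF Suc.prems(2)])
qed

lemma Ck_on_compose:
  fixes \<phi> :: "real \<Rightarrow> real" and f :: "'a::euclidean_space \<Rightarrow> real"
  shows "Ck_on k UNIV \<phi> \<Longrightarrow> Ck_on k UNIV f \<Longrightarrow> Ck_on k UNIV (\<lambda>p. \<phi> (f p))"
proof (induction k arbitrary: \<phi> f)
  case 0
  then show ?case by (auto intro: continuous_on_compose2)
next
  case (Suc k)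
  obtain \<phi>' where \<phi>: "\<And>p. (\<phi> has_derivative \<phi>' p) (at p)" "\<And>v. Ck_on k UNIV (\<lambda>p. \<phi>' p v)"
    using Ck_on_SucE[OF Suc.prems(1)] by blast
  obtain f' where f: "\<And>p. (f has_derivative f' p) (at p)" "\<And>v. Ck_on k UNIV (\<lambda>p. f' p v)"
    using Ck_on_SucE[OF Suc.prems(2)] by blast
  \<comment> \<open>A derivative on the reals is multiplication by its value at 1; this turns the
    chain rule into a product, to which \<open>Ck_on_mult\<close> applies.\<close>
  have lin: "\<phi>' x v = \<phi>' x 1 * v" for x v
    using linear_scale[OF has_derivative_linear[OF \<phi>(1)[of x]], of v 1] by (simp add: mult.commute)
  have "((\<lambda>p. \<phi> (f p)) has_derivative (\<lambda>v. \<phi>' (f p) 1 * f' p v)) (at p)" for p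
    using has_derivative_compose[OF f(1) \<phi>(1)] lin by (metis (no_types, lifting) ext)
  then show ?case
    by (rule Ck_on_SucI) (intro Ck_on_mult Suc.IH[of "\<lambda>p. \<phi>' p 1"] f \<phi> Ck_on_pred[OF Suc.prems(1)] Ck_on_pred[OF Suc.prems(2)])
qed

lemma Ck_on_exp:
  fixes f :: "'a::euclidean_space \<Rightarrow> real"
  shows "Ck_on k UNIV f \<Longrightarrow> Ck_on k UNIV (\<lambda>p. exp (f p))"
proof (induction k)
  case 0
  then show ?case by (auto intro: continuous_intros)
next
  case (Suc k)
  obtain f' where f: "\<And>p. (f has_derivative f' p) (at p)" "\<And>v. Ck_on k UNIV (\<lambda>p. f' p v)"
    using Ck_on_SucE[OF Suc.prems] by blast
  show ?case
    by (rule Ck_on_SucI[OF has_derivative_exp[OF f(1)]])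
      (intro Ck_on_mult f Suc.IH Ck_on_pred[OF Suc.prems])
qed

text \<open>The exponent is generalised in the induction because differentiation lowers it by 1.
  Exponents -1/2 and -1 supply reciprocal square roots and reciprocals.\<close>

lemma Ck_on_powr:
  fixes f :: "'a::euclidean_space \<Rightarrow> real"
  assumes "\<And>p. f p > 0"
  shows "Ck_on k UNIV f \<Longrightarrow> Ck_on k UNIV (\<lambda>p. f p powr a)"
proof (induction k arbitrary: a)
  case 0
  then show ?case using assms
    by (auto intro!: continuous_intros simp: less_imp_neq[THEN not_sym])
next
  case (Suc k)
  obtain f' where f: "\<And>p. (f has_derivative f' p) (at p)" "\<And>v. Ck_on k UNIV (\<lambda>p. f' p v)"
    using Ck_on_SucE[OF Suc.prems] by blast
  have "((\<lambda>p. f p powr a) has_derivative (\<lambda>v. a * f p powr (a - 1) * f' p v)) (at p)" for p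
    using DERIV_compose_FDERIV[OF has_real_derivative_powr[OF assms] f(1)] by (simp add: mult_ac)
  then show ?case
    by (rule Ck_on_SucI) (intro Ck_on_mult Ck_on_const f Suc.IH Ck_on_pred[OF Suc.prems])
qed

lemma Ck_on_real_Suc_iff:
  fixes f f' :: "real \<Rightarrow> real"
  assumes "\<And>x. (f has_real_derivative f' x) (at x)"
  shows "Ck_on (Suc k) UNIV f \<longleftrightarrow> Ck_on k UNIV f'"
proof -
  have D: "(f has_derivative (\<lambda>v. f' x * v)) (at x)" for x
    using assms by (simp add: has_field_derivative_def)
  have "Ck_on k UNIV f'" if "Ck_on (Suc k) UNIV f"
  proof -
    have "Ck_on k UNIV (\<lambda>x. frechet_derivative f (at x) 1)" using that by simp
    moreover have "frechet_derivative f (at x) 1 = f' x" for x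
      using fun_cong[OF frechet_derivative_at[OF D], of x 1] by simp
    ultimately show ?thesis by simp
  qed
  moreover have "Ck_on (Suc k) UNIV f" if "Ck_on k UNIV f'"
    by (rule Ck_on_SucI[OF D]) (intro Ck_on_mult that Ck_on_const)
  ultimately show ?thesis by blast
qed

text \<open>Used in both directions: \<open>F\<close> inherits smoothness from \<open>slope\<close>,
  and \<open>XD\<close> inherits it from \<open>X\<close>.\<close>

lemma smooth_on_real_antiderivative:
  fixes f f' :: "real \<Rightarrow> real"
  assumes "\<And>x. (f has_real_derivative f' x) (at x)"
  shows "smooth_on UNIV f \<longleftrightarrow> smooth_on UNIV f'"
  unfolding smooth_on_def
  using Ck_on_real_Suc_iff[of f f', OF assms] Ck_on_pred by blast

text \<open>Bootstrapping: if f is C^k, then so is its derivative g(f), hence f is C^(k+1). Meant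
  for the inverse of a function X, which satisfies such an equation with g = 1/X'.\<close>

lemma smooth_on_autonomous_ode:
  fixes f g :: "real \<Rightarrow> real"
  assumes g: "smooth_on UNIV g" and f: "\<And>x. (f has_real_derivative g (f x)) (at x)"
  shows "smooth_on UNIV f"
  unfolding smooth_on_def
proof
  fix k
  show "Ck_on k UNIV f"
  proof (induction k)
    case 0
    show ?case using f DERIV_isCont by (auto intro!: continuous_at_imp_continuous_on)
  next
    case (Suc k)
    then show ?case
      using g by (simp only: Ck_on_real_Suc_iff[OF f]) (auto simp: smooth_on_def intro: Ck_on_compose)
  qed
qed

lemma smooth_on_const: "smooth_on UNIV (\<lambda>p. c)"
  by (simp add: smooth_on_def Ck_on_const)

lemma smooth_on_bounded_linear: "bounded_linear L \<Longrightarrow> smooth_on UNIV L"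
  by (simp add: smooth_on_def Ck_on_bounded_linear)

lemma smooth_on_add:
  "smooth_on UNIV f \<Longrightarrow> smooth_on UNIV g \<Longrightarrow> smooth_on UNIV (\<lambda>p. f p + g p)"
  by (simp add: smooth_on_def Ck_on_add)

lemma smooth_on_mult:
  fixes f g :: "'a::euclidean_space \<Rightarrow> real"
  shows "smooth_on UNIV f \<Longrightarrow> smooth_on UNIV g \<Longrightarrow> smooth_on UNIV (\<lambda>p. f p * g p)"
  by (simp add: smooth_on_def Ck_on_mult)

lemma smooth_on_diff:
  fixes f g :: "'a::euclidean_space \<Rightarrow> real"
  shows "smooth_on UNIV f \<Longrightarrow> smooth_on UNIV g \<Longrightarrow> smooth_on UNIV (\<lambda>p. f p - g p)"
  using smooth_on_add[of f "\<lambda>p. - 1 * g p"] smooth_on_mult[of "\<lambda>p. - 1" g] smooth_on_const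
  by fastforce

lemma smooth_on_divide_const:
  fixes f :: "'a::euclidean_space \<Rightarrow> real"
  shows "smooth_on UNIV f \<Longrightarrow> smooth_on UNIV (\<lambda>p. f p / a)"
  using smooth_on_mult[OF _ smooth_on_const[of "1 / a"], of f] by simp

lemma smooth_on_power:
  fixes f :: "'a::euclidean_space \<Rightarrow> real"
  shows "smooth_on UNIV f \<Longrightarrow> smooth_on UNIV (\<lambda>p. f p ^ n)"
  by (induction n) (auto intro: smooth_on_mult smooth_on_const)

lemma smooth_on_exp:
  fixes f :: "'a::euclidean_space \<Rightarrow> real"
  shows "smooth_on UNIV f \<Longrightarrow> smooth_on UNIV (\<lambda>p. exp (f p))"
  by (simp add: smooth_on_def Ck_on_exp)

lemma smooth_on_powr:
  fixes f :: "'a::euclidean_space \<Rightarrow> real"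
  shows "(\<And>p. f p > 0) \<Longrightarrow> smooth_on UNIV f \<Longrightarrow> smooth_on UNIV (\<lambda>p. f p powr a)"
  by (simp add: smooth_on_def Ck_on_powr)

lemma smooth_on_compose:
  fixes \<phi> :: "real \<Rightarrow> real" and f :: "'a::euclidean_space \<Rightarrow> real"
  shows "smooth_on UNIV \<phi> \<Longrightarrow> smooth_on UNIV f \<Longrightarrow> smooth_on UNIV (\<lambda>p. \<phi> (f p))"
  by (simp add: smooth_on_def Ck_on_compose)

lemmas smooth_on_intros =
  smooth_on_const smooth_on_bounded_linear[OF bounded_linear_ident] smooth_on_add smooth_on_diff
  smooth_on_mult smooth_on_divide_const smooth_on_power smooth_on_exp

section \<open>Ends of a space with a proper real function\<close>

text \<open>The sets \<open>D R\<close> are cofinal among the compact subsets of S, and for R \<ge>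
  0 the complement of each has the two tails \<open>T 1 R\<close> and \<open>T (-1) R\<close> as
  components; an end amounts to the choice of a sign.\<close>

lemma card_topological_ends_eq_2:
  fixes S :: "'a::t2_space set" and f :: "'a \<Rightarrow> real"
  assumes cont: "continuous_on S f"
    and compact: "\<And>R. compact {q\<in>S. \<bar>f q\<bar> \<le> R}"
    and conn: "\<And>R \<sigma>. R \<ge> 0 \<Longrightarrow> \<sigma> \<in> {-1, 1} \<Longrightarrow> connected {q\<in>S. \<sigma> * f q > R}"
    and unbounded: "\<And>R \<sigma>. \<sigma> \<in> {-1, 1} \<Longrightarrow> \<exists>q\<in>S. \<sigma> * f q > R"
  shows "card (topological_ends S) = 2"
proof -
  define D where "D R = {q\<in>S. \<bar>f q\<bar> \<le> R}" for R
  define T where "T \<sigma> R = {q\<in>S. \<sigma> * f q > R}" for \<sigma> R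
  have D: "compact (D R)" "D R \<subseteq> S" for R
    using compact by (auto simp: D_def)
  have T_nonempty: "T \<sigma> R \<noteq> {}" if "\<sigma> \<in> {-1, 1}" for \<sigma> R
    using unbounded[OF that] by (auto simp: T_def)
  have T_conn: "connected (T \<sigma> R)" if "\<sigma> \<in> {-1, 1}" "R \<ge> 0" for \<sigma> R
    using conn[OF that(2,1)] by (simp add: T_def)
  have T_anti: "T \<sigma> R' \<subseteq> T \<sigma> R" if "R \<le> R'" for \<sigma> R R'
    using that by (auto simp: T_def)
  have T_disj: "T 1 R \<inter> T (-1) R' = {}" if "R \<ge> 0" "R' \<ge> 0" for R R'
    using that by (auto simp: T_def)
  have S_diff: "S - D R = T 1 R \<union> T (-1) R" if "R \<ge> 0" for R
    using that by (auto simp: D_def T_def)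

  have bound: "\<exists>R\<ge>0. C \<subseteq> D R" if C: "compact C" "C \<subseteq> S" for C
  proof -
    have "compact (f ` C)"
      using C cont by (meson compact_continuous_image continuous_on_subset)
    then obtain B where "\<And>x. x \<in> f ` C \<Longrightarrow> \<bar>x\<bar> \<le> B"
      using compact_imp_bounded[of "f ` C"] by (auto simp: bounded_iff)
    then have "C \<subseteq> D (max 0 B)"
      using C by (force simp: D_def)
    then show ?thesis by (meson max.cobounded1)
  qed

  \<comment> \<open>Maximality: a larger connected set would meet the opposite tail, so f would
    vanish somewhere on it, whereas zeros of f lie in \<open>D R\<close>.\<close>
  have T_component: "T \<sigma> R \<in> components (S - D R)" if "\<sigma> \<in> {-1, 1}" "R \<ge> 0" for \<sigma> R
    unfolding in_components_maximal
  proof (intro conjI allI impI)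
    show "T \<sigma> R \<noteq> {}" "T \<sigma> R \<subseteq> S - D R" "connected (T \<sigma> R)"
      using that T_nonempty T_conn S_diff by auto
  next
    fix X assume X: "X \<noteq> {} \<and> T \<sigma> R \<subseteq> X \<and> X \<subseteq> S - D R \<and> connected X"
    have "connected (f ` X)"
      using X cont connected_continuous_image continuous_on_subset by (metis Diff_subset subset_trans)
    obtain a where a: "a \<in> T \<sigma> R" using T_nonempty \<open>\<sigma> \<in> _\<close> by blast
    show "X = T \<sigma> R"
    proof (rule ccontr)
      assume "X \<noteq> T \<sigma> R"
      then obtain b where b: "b \<in> X" "b \<notin> T \<sigma> R" using X by blast
      have "a \<in> X" "\<sigma> * f a > R" using X a by (auto simp: T_def)
      moreover have "\<sigma> * f b < - R"
        using b X S_diff[OF \<open>R \<ge> 0\<close>] that by (auto simp: T_def)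
      ultimately have "0 \<in> f ` X"
        using \<open>connected (f ` X)\<close> b(1) that by (auto simp: connected_iff_interval)
      then obtain c where "c \<in> X" "f c = 0" by force
      then show False using X that by (auto simp: D_def)
    qed
  qed
  have components_D: "components (S - D R) \<subseteq> {T 1 R, T (-1) R}" if "R \<ge> 0" for R
  proof
    fix c assume c: "c \<in> components (S - D R)"
    then obtain x where x: "x \<in> c" "x \<in> S - D R"
      by (metis ex_in_conv in_components_nonempty in_components_subset subsetD)
    then have "x \<in> T 1 R \<or> x \<in> T (-1) R" using S_diff that by auto
    then show "c \<in> {T 1 R, T (-1) R}"
      using components_nonoverlap[OF c T_component[OF _ that]] x(1) by auto
  qed

  \<comment> \<open>The end on side \<open>\<sigma>\<close> assigns to C the component containing a
    tail of that side. The restricted lambda makes it \<open>undefined\<close> elsewhere, as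
    membership in the extensional product requires.\<close>
  define E where "E \<sigma> = (\<lambda>C\<in>{C. compact C \<and> C \<subseteq> S}.
      THE c. c \<in> components (S - C) \<and> (\<exists>R\<ge>0. C \<subseteq> D R \<and> T \<sigma> R \<subseteq> c))" for \<sigma>
  have E: "E \<sigma> C \<in> components (S - C) \<and> (\<exists>R\<ge>0. C \<subseteq> D R \<and> T \<sigma> R \<subseteq> E \<sigma> C)"
    and E_unique: "\<And>c R. \<lbrakk>c \<in> components (S - C); T \<sigma> R \<subseteq> c\<rbrakk> \<Longrightarrow> c = E \<sigma> C"
    if \<sigma>: "\<sigma> \<in> {-1, 1}" and C: "compact C" "C \<subseteq> S" for \<sigma> C
  proof -
    have uniq: "c = c'" if "c \<in> components (S - C)" "T \<sigma> R \<subseteq> c"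
        and "c' \<in> components (S - C)" "T \<sigma> R' \<subseteq> c'" for c c' R R'
    proof -
      have "T \<sigma> (max R R') \<subseteq> c \<inter> c'"
        using that T_anti[of R "max R R'" \<sigma>] T_anti[of R' "max R R'" \<sigma>] by auto
      then have "c \<inter> c' \<noteq> {}" using T_nonempty[OF \<sigma>, of "max R R'"] by blast
      then show ?thesis using components_nonoverlap that by blast
    qed
    obtain R where R: "R \<ge> 0" "C \<subseteq> D R" using bound[OF C] by blast
    have "T \<sigma> R \<subseteq> S - C"
      using in_components_subset[OF T_component[OF \<sigma> R(1)]] R(2) by auto
    then obtain c where c: "c \<in> components (S - C)" "T \<sigma> R \<subseteq> c"
      using exists_component_superset T_conn[OF \<sigma> R(1)] T_nonempty[OF \<sigma>] by (metis subset_empty)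
    have "\<exists>!c. c \<in> components (S - C) \<and> (\<exists>R\<ge>0. C \<subseteq> D R \<and> T \<sigma> R \<subseteq> c)"
      using c R uniq by blast
    from theI'[OF this] show *: "E \<sigma> C \<in> components (S - C) \<and> (\<exists>R\<ge>0. C \<subseteq> D R \<and> T \<sigma> R \<subseteq> E \<sigma> C)"
      using C by (simp add: E_def)
    show "c = E \<sigma> C" if "c \<in> components (S - C)" "T \<sigma> R \<subseteq> c" for c R
      using * uniq that by blast
  qed
  have E_D: "E \<sigma> (D R) = T \<sigma> R" if "\<sigma> \<in> {-1, 1}" "R \<ge> 0" for \<sigma> R
    using E_unique[OF that(1) D T_component[OF that] order_refl] by simp

  have E_ends: "E \<sigma> \<in> topological_ends S" if \<sigma>: "\<sigma> \<in> {-1, 1}" for \<sigma>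
    unfolding topological_ends_def
  proof (intro CollectI conjI allI impI)
    show "E \<sigma> \<in> (\<Pi>\<^sub>E C\<in>{C. compact C \<and> C \<subseteq> S}. components (S - C))"
      using E[OF \<sigma>] by (auto simp: E_def PiE_def extensional_def Pi_def)
  next
    fix C A assume CA: "compact C \<and> compact A \<and> C \<subseteq> A \<and> A \<subseteq> S"
    then have C: "compact C" "C \<subseteq> S" and A: "compact A" "A \<subseteq> S" by auto
    obtain R where R: "T \<sigma> R \<subseteq> E \<sigma> A" and EA: "E \<sigma> A \<in> components (S - A)" using E[OF \<sigma> A] by blast
    have "E \<sigma> A \<subseteq> S - C" using in_components_subset[OF EA] CA by blast
    then obtain c where c: "c \<in> components (S - C)" "E \<sigma> A \<subseteq> c"
      using exists_component_superset in_components_connected[OF EA] in_components_nonempty[OF EA]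
      by (metis subset_empty)
    then show "E \<sigma> A \<subseteq> E \<sigma> C" using E_unique[OF \<sigma> C c(1)] R by blast
  qed

  have "\<epsilon> \<in> {E 1, E (-1)}" if \<epsilon>: "\<epsilon> \<in> topological_ends S" for \<epsilon>
  proof -
    have comp: "\<epsilon> C \<in> components (S - C)" if "compact C" "C \<subseteq> S" for C
      using \<epsilon> that by (auto simp: topological_ends_def)
    have mono: "\<epsilon> A \<subseteq> \<epsilon> C" if "compact C" "compact A" "C \<subseteq> A" "A \<subseteq> S" for C A
      using \<epsilon> that by (auto simp: topological_ends_def)
    have "\<epsilon> (D 0) = T 1 0 \<or> \<epsilon> (D 0) = T (-1) 0"
      using comp[OF D, of 0] components_D[of 0] by auto
    then obtain \<sigma> where \<sigma>: "\<sigma> \<in> {-1, 1}" "\<epsilon> (D 0) = T \<sigma> 0"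
      by (meson insertCI)
    \<comment> \<open>The sign found at R = 0 persists: the component at R lies inside
      \<open>T \<sigma> 0\<close>, which the opposite tail does not meet.\<close>
    have \<epsilon>_D: "\<epsilon> (D R) = T \<sigma> R" if "R \<ge> 0" for R
    proof -
      have "D 0 \<subseteq> D R" using that by (auto simp: D_def)
      then have "\<epsilon> (D R) \<subseteq> T \<sigma> 0"
        using mono[OF D(1) D(1) _ D(2), of 0 R] \<sigma>(2) by simp
      moreover have "\<epsilon> (D R) \<in> {T 1 R, T (-1) R}"
        using comp[OF D] components_D[OF that] by blast
      moreover have "T (- \<sigma>) R \<inter> T \<sigma> 0 = {}"
        using T_disj[of R 0] T_disj[of 0 R] that \<sigma>(1) by auto
      moreover have "T (- \<sigma>) R \<noteq> {}"
        using T_nonempty[of "- \<sigma>" R] \<sigma>(1) by auto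
      ultimately show ?thesis using \<sigma>(1) by auto
    qed
    have "\<epsilon> C = E \<sigma> C" for C
    proof (cases "compact C \<and> C \<subseteq> S")
      case True
      then obtain R where R: "R \<ge> 0" "C \<subseteq> D R" using bound by blast
      then have "T \<sigma> R \<subseteq> \<epsilon> C"
        using mono[of C "D R"] True D \<epsilon>_D by metis
      then show ?thesis using E_unique[OF \<sigma>(1)] True comp by blast
    next
      \<comment> \<open>Here both functions are \<open>undefined\<close>, by extensionality.\<close>
      case False
      then show ?thesis using \<epsilon> by (auto simp: topological_ends_def PiE_def extensional_def E_def)
    qed
    then show ?thesis using \<sigma>(1) by auto
  qed
  then have "topological_ends S = {E 1, E (-1)}" using E_ends by auto
  moreover have "E 1 \<noteq> E (-1)"
  proof
    assume "E 1 = E (-1)"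
    then have "T 1 0 = T (-1) 0" using E_D[of 1 0] E_D[of "-1" 0] by simp
    then show False using T_disj[of 0 0] T_nonempty[of 1 0] by auto
  qed
  ultimately show ?thesis by simp
qed

section \<open>Kruskal geometry\<close>

lemma sphere_curve_velocity:
  fixes \<gamma> :: "real \<Rightarrow> 'a::real_inner"
  assumes "\<And>s. norm (\<gamma> s) = 1" and "(\<gamma> has_vector_derivative w) (at 0)"
  shows "w \<bullet> \<gamma> 0 = 0"
proof -
  have "\<gamma> s \<bullet> \<gamma> s = 1" for s
    using assms(1)[of s] by (simp add: norm_eq_1)
  moreover have "((\<lambda>s. \<gamma> s \<bullet> \<gamma> s) has_derivative (\<lambda>h. \<gamma> 0 \<bullet> h *\<^sub>R w + h *\<^sub>R w \<bullet> \<gamma> 0)) (at 0)"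
    using assms(2) unfolding has_vector_derivative_def by (intro has_derivative_inner)
  ultimately have "((\<lambda>s::real. 1) has_derivative (\<lambda>h. \<gamma> 0 \<bullet> h *\<^sub>R w + h *\<^sub>R w \<bullet> \<gamma> 0)) (at 0)"
    by simp
  from fun_cong[OF has_derivative_unique[OF this has_derivative_const], of 1] show ?thesis
    by (simp add: inner_commute)
qed

text \<open>Radial projection of the line \<open>\<omega> + s *\<^sub>R w\<close> to the sphere. By
  orthogonality its squared norm is 1 + s^2 |w|^2, stationary at 0, so the velocity there stays
  w.\<close>

lemma sphere_curve_exists:
  fixes \<omega> w :: "'a::real_inner"
  assumes "norm \<omega> = 1" and "w \<bullet> \<omega> = 0"
  obtains \<gamma> :: "real \<Rightarrow> 'a"
  where "\<And>s. norm (\<gamma> s) = 1" and "\<gamma> 0 = \<omega>" and "(\<gamma> has_vector_derivative w) (at 0)"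
proof
  define \<gamma> where "\<gamma> s = (1 / sqrt (1 + s\<^sup>2 * (w \<bullet> w))) *\<^sub>R (\<omega> + s *\<^sub>R w)" for s
  have pos: "1 + s\<^sup>2 * (w \<bullet> w) > 0" for s
    by (simp add: add_pos_nonneg)
  show "norm (\<gamma> s) = 1" for s
  proof -
    have "\<omega> \<bullet> \<omega> = 1" using assms by (simp add: norm_eq_1)
    then have "(\<omega> + s *\<^sub>R w) \<bullet> (\<omega> + s *\<^sub>R w) = 1 + s\<^sup>2 * (w \<bullet> w)"
      using assms(2) by (simp add: inner_simps inner_commute power2_eq_square)
    then have "norm (\<omega> + s *\<^sub>R w) = sqrt (1 + s\<^sup>2 * (w \<bullet> w))"
      by (simp add: norm_eq_sqrt_inner)
    then show ?thesis using pos[of s] by (simp add: \<gamma>_def)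
  qed
  show "\<gamma> 0 = \<omega>" by (simp add: \<gamma>_def)
  show "(\<gamma> has_vector_derivative w) (at 0)"
    unfolding \<gamma>_def
    by (rule has_vector_derivative_eq_rhs)
      (auto intro!: derivative_eq_intros simp: has_vector_derivative_def)
qed

lemma norm_orthogonal_matrix_vector_mult:
  fixes A :: "real ^ 'n ^ 'n"
  assumes "orthogonal_matrix A"
  shows "norm (A *v x) = norm x"
  using assms orthogonal_transformation_matrix[of "(*v) A"]
  by (simp add: orthogonal_transformation)

text \<open>Parseval's identity: the vectors are the rows of an orthogonal matrix, which preserves
  norms. The index set is that of \<open>orthonormal_frame\<close>.\<close>

lemma orthonormal_sum_inner_power2:
  fixes v :: "nat \<Rightarrow> real ^ 3"
  assumes "\<And>i j. i \<in> {1..3} \<Longrightarrow> j \<in> {1..3} \<Longrightarrow> v i \<bullet> v j = (if i = j then 1 else 0)"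
  shows "(\<Sum>i=1..3. (v i \<bullet> x)\<^sup>2) = x \<bullet> x"
proof -
  define A :: "real ^ 3 ^ 3" where "A = vector [v 1, v 2, v 3]"
  have A: "A $ 1 = v 1" "A $ 2 = v 2" "A $ 3 = v 3"
    by (simp_all add: A_def)
  have "orthogonal_matrix A"
    unfolding orthogonal_matrix_orthonormal_rows forall_3
    by (simp add: row_def A vec_lambda_eta orthogonal_def norm_eq_1 assms)
  then have "norm (A *v x) = norm x"
    by (rule norm_orthogonal_matrix_vector_mult)
  then have "(A *v x) \<bullet> (A *v x) = x \<bullet> x"
    by (simp add: norm_eq)
  moreover have "(A *v x) $ i = A $ i \<bullet> x" for i
    by (simp add: matrix_vector_mult_def inner_vec_def)
  ultimately have "(v 1 \<bullet> x)\<^sup>2 + (v 2 \<bullet> x)\<^sup>2 + (v 3 \<bullet> x)\<^sup>2 = x \<bullet> x"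
    by (simp add: inner_vec_def[of "A *v x"] sum_3 A power2_eq_square)
  moreover have "{1..3::nat} = {1, 2, 3}" by auto
  ultimately show ?thesis by simp
qed

section \<open>The area radius as a function of UV\<close>

lemma radius_eqI:
  assumes M: "M > 0" and r: "r > 0" "(r - 2 * M) * exp (r / (2 * M)) = U * V"
  shows "radius M U V = r"
  unfolding radius_def
proof (rule the_equality)
  let ?f = "\<lambda>r. (r - 2 * M) * exp (r / (2 * M))"
  \<comment> \<open>Uniqueness of the root: the derivative x exp(x/2M)/(2M) is positive on the
    positive axis.\<close>
  have mono: "?f a < ?f b" if "0 < a" "a < b" for a b
  proof (rule DERIV_pos_imp_increasing[OF that(2)])
    fix x assume "a \<le> x" "x \<le> b"
    moreover have "(?f has_real_derivative exp (x / (2 * M)) * x / (2 * M)) (at x)"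
      using M by (auto intro!: derivative_eq_intros simp: field_simps)
    ultimately show "\<exists>y. (?f has_real_derivative y) (at x) \<and> 0 < y"
      using M that by (intro exI[of _ "exp (x / (2 * M)) * x / (2 * M)"]) auto
  qed
  fix s assume s: "s > 0 \<and> ?f s = U * V"
  then show "s = r"
    using mono[of s r] mono[of r s] r by (cases s r rule: linorder_cases) auto
qed (use r in auto)

lemma radius:
  assumes M: "M > 0" and UV: "U * V > - 2 * M"
  shows radius_pos: "radius M U V > 0"
    and radius_eq: "(radius M U V - 2 * M) * exp (radius M U V / (2 * M)) = U * V"
proof -
  \<comment> \<open>At \<open>?b\<close> the first factor of \<open>?f\<close> is |UV| and the
    exponential is at least 1, so the value is at least UV; at r = 0 it is -2M < UV.\<close>
  let ?f = "\<lambda>r. (r - 2 * M) * exp (r / (2 * M))" and ?b = "2 * M + \<bar>U * V\<bar>"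
  have "1 \<le> exp (?b / (2 * M))" using M by simp
  then have "\<bar>U * V\<bar> * 1 \<le> ?f ?b" unfolding add_diff_cancel_left'
    by (rule mult_left_mono) simp
  then have "\<exists>r\<ge>0. r \<le> ?b \<and> ?f r = U * V"
    using M UV by (intro IVT') (auto intro!: continuous_intros)
  then obtain r where r: "r \<ge> 0" "?f r = U * V" by blast
  then have "r > 0" using M UV by (cases "r = 0") auto
  with r show "radius M U V > 0" "?f (radius M U V) = U * V"
    using radius_eqI[OF M] by auto
qed

lemma radius_gt:
  assumes "M > 0" and "U * V > 0"
  shows "radius M U V > 2 * M"
proof -
  have "(radius M U V - 2 * M) * exp (radius M U V / (2 * M)) > 0"
    using assms by (subst radius_eq) auto
  then show ?thesis by (simp add: zero_less_mult_iff)
qed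

text \<open>The radius depends on z = UV alone, so setting U = 1 reduces its calculus to an inverse
  function of one variable.\<close>

lemma radius_has_derivative:
  assumes M: "M > 0" and z: "z > - 2 * M"
  defines "r \<equiv> radius M 1 z"
  shows "(radius M 1 has_real_derivative 2 * M * exp (- r / (2 * M)) / r) (at z)"
proof -
  let ?f = "\<lambda>r. (r - 2 * M) * exp (r / (2 * M))"
  have r: "r > 0" "?f r = z"
    using radius_pos[OF M, of 1 z] radius_eq[OF M, of 1 z] z by (simp_all add: r_def)
  have inv: "radius M 1 (?f s) = s" if "s > 0" for s
    using radius_eqI[OF M that] by simp
  have "isCont (radius M 1) (?f r)"
    \<comment> \<open>The bounds r/2 and 2r only serve to enclose r in an interval of positive
      numbers, where \<open>inv\<close> applies.\<close>
    by (rule isCont_inverse_function2[of "r / 2" _ "2 * r"]) (use r inv M in auto)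
  then have cont: "isCont (radius M 1) z" using r by simp
  have "(radius M 1 has_real_derivative inverse (exp (r / (2 * M)) * r / (2 * M))) (at z)"
  proof (rule DERIV_inverse_function[of ?f _ _ _ "- 2 * M" "z + 1"])
    show "(?f has_real_derivative exp (r / (2 * M)) * r / (2 * M)) (at (radius M 1 z))"
      unfolding r_def using M by (auto intro!: derivative_eq_intros simp: field_simps)
    show "?f (radius M 1 y) = y" if "- 2 * M < y" for y
      using radius_eq[OF M, of 1 y] that by simp
  qed (use r M z cont in auto)
  moreover have "inverse (exp (r / (2 * M)) * r / (2 * M)) = 2 * M * exp (- r / (2 * M)) / r"
    by (simp add: exp_minus field_simps)
  ultimately show ?thesis by simp
qed

lemma radius_conv: "radius M U V = radius M 1 (U * V)"
  by (simp add: radius_def)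

section \<open>Tangent spaces, metric derivatives and the connection of the Kruskal
  extension\<close>

lemma tangent_space_mono: "S \<subseteq> K \<Longrightarrow> tangent_space S p \<subseteq> tangent_space K p"
  unfolding tangent_space_def by (intro Collect_mono impI, elim exE, rule exI) auto

lemma tangent_space_kruskal:
  assumes p: "(U, V, \<omega>) \<in> kruskal M"
  shows "(a, b, w) \<in> tangent_space (kruskal M) (U, V, \<omega>) \<longleftrightarrow> w \<bullet> \<omega> = 0"
proof
  assume "(a, b, w) \<in> tangent_space (kruskal M) (U, V, \<omega>)"
  then obtain \<gamma> where \<gamma>: "\<And>s. \<gamma> s \<in> kruskal M" "\<gamma> 0 = (U, V, \<omega>)"
    "(\<gamma> has_vector_derivative (a, b, w)) (at 0)"
    by (auto simp: tangent_space_def)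
  have "((\<lambda>s. snd (snd (\<gamma> s))) has_vector_derivative w) (at 0)"
    using bounded_linear.has_vector_derivative[OF bounded_linear_compose[OF bounded_linear_snd bounded_linear_snd] \<gamma>(3)]
    by (simp add: o_def)
  then show "w \<bullet> \<omega> = 0"
    using sphere_curve_velocity[of "\<lambda>s. snd (snd (\<gamma> s))" w] \<gamma>(1,2)
    by (auto simp: kruskal_def split_beta)
next
  assume "w \<bullet> \<omega> = 0"
  moreover have "norm \<omega> = 1" and UV: "U * V > - 2 * M" using p by (auto simp: kruskal_def)
  ultimately obtain c where c: "\<And>s. norm (c s) = 1" "c 0 = \<omega>" "(c has_vector_derivative w) (at 0)"
    using sphere_curve_exists by metis
  define I where "I = {s. (U + s * a) * (V + s * b) > - 2 * M}"
  have I: "open I" "0 \<in> I"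
    using UV by (auto simp: I_def intro!: open_Collect_less continuous_intros)
  \<comment> \<open>\<open>tangent_space\<close> asks for a curve at all real times, but the
    straight line in (U, V) may leave the open set UV > -2M; outside \<open>I\<close> the curve is
    parked at the point.\<close>
  define \<gamma> where "\<gamma> s = (if s \<in> I then (U + s * a, V + s * b, c s) else (U, V, \<omega>))" for s
  have "((\<lambda>s. (U + s * a, V + s * b, c s)) has_vector_derivative (a, b, w)) (at 0)"
    by (intro has_vector_derivative_Pair c(3)) (auto intro!: derivative_eq_intros)
  then have "(\<gamma> has_vector_derivative (a, b, w)) (at 0)"
    by (rule has_vector_derivative_transform_within_open[OF _ I]) (simp add: \<gamma>_def)
  moreover have "\<gamma> s \<in> kruskal M" for s
    using p c(1) by (auto simp: \<gamma>_def I_def kruskal_def)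
  moreover have "\<gamma> 0 = (U, V, \<omega>)" using I c(2) by (simp add: \<gamma>_def)
  ultimately show "(a, b, w) \<in> tangent_space (kruskal M) (U, V, \<omega>)"
    unfolding tangent_space_def by blast
qed

definition kruskal_factor :: "real \<Rightarrow> real \<Rightarrow> real" where
  "kruskal_factor M r = 16 * M\<^sup>2 * exp (- r / (2 * M)) / r"

lemma kruskal_metric_eq:
  "kruskal_metric M (U, V, \<omega>) (a, b, w) (a', b', w') =
     kruskal_factor M (radius M U V) * ((a * b' + b * a') / 2) + (radius M U V)\<^sup>2 * (w \<bullet> w')"
  by (simp add: kruskal_metric_def kruskal_factor_def Let_def)

text \<open>The metric depends on the base point only through r, so the chain rule gives dr(a, b,
  c), the first line of the right side, times an r-derivative. The logarithmic derivative of
  \<open>kruskal_factor\<close> is -(1/(2M) + 1/r).\<close>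

lemma metric_deriv_kruskal:
  fixes r :: real
  assumes M: "M > 0" and p: "(U, V, \<omega>) \<in> kruskal M"
  defines "r \<equiv> radius M U V"
  shows "metric_deriv (kruskal_metric M) (U, V, \<omega>) (a, b, c) (y1, y2, y3) (z1, z2, z3) =
     2 * M * exp (- r / (2 * M)) / r * (a * V + b * U) *
       (2 * r * (y3 \<bullet> z3)
        - kruskal_factor M r * (1 / (2 * M) + 1 / r) * ((y1 * z2 + y2 * z1) / 2))"
proof -
  define \<kappa> where "\<kappa> = 2 * M * exp (- r / (2 * M)) / r"
  have UV: "U * V > - 2 * M" using p by (simp add: kruskal_def)
  then have r: "r > 0" unfolding r_def by (rule radius_pos[OF M])
  have R1: "((\<lambda>q::event. fst q * fst (snd q)) has_derivative (\<lambda>q. fst q * V + fst (snd q) * U)) (at (U, V, \<omega>))"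
    by (auto intro!: derivative_eq_intros simp: fun_eq_iff algebra_simps)
  have "(radius M 1 has_derivative (*) \<kappa>) (at (fst (U, V, \<omega>) * fst (snd (U, V, \<omega>))))"
    using radius_has_derivative[OF M UV]
    by (simp add: has_field_derivative_def \<kappa>_def r_def radius_conv[of M U V])
  from has_derivative_compose[OF R1 this]
  have R: "((\<lambda>q::event. radius M (fst q) (fst (snd q))) has_derivative
      (\<lambda>q. \<kappa> * (fst q * V + fst (snd q) * U))) (at (U, V, \<omega>))"
    by (subst radius_conv) simp
  define \<sigma> where "\<sigma> = 1 / (2 * M) + 1 / r"
  have "(kruskal_factor M has_real_derivative - kruskal_factor M r * \<sigma>) (at r)"
    unfolding kruskal_factor_def \<sigma>_def using r M
    by (auto intro!: derivative_eq_intros simp: field_simps power2_eq_square)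
  then have K: "((\<lambda>q::event. kruskal_factor M (radius M (fst q) (fst (snd q)))) has_derivative
      (\<lambda>q. \<kappa> * (fst q * V + fst (snd q) * U) * (- kruskal_factor M r * \<sigma>))) (at (U, V, \<omega>))"
    by (intro DERIV_compose_FDERIV[OF _ R]) (simp add: r_def)
  have "((\<lambda>q::event. kruskal_metric M q (y1, y2, y3) (z1, z2, z3)) has_derivative
     (\<lambda>q. \<kappa> * (fst q * V + fst (snd q) * U) *
       (2 * r * (y3 \<bullet> z3)
        - kruskal_factor M r * \<sigma> * ((y1 * z2 + y2 * z1) / 2)))) (at (U, V, \<omega>))"
  proof -
    have eq: "(\<lambda>q::event. kruskal_metric M q (y1, y2, y3) (z1, z2, z3)) =
      (\<lambda>q. kruskal_factor M (radius M (fst q) (fst (snd q))) * ((y1 * z2 + y2 * z1) / 2)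
         + (radius M (fst q) (fst (snd q)))\<^sup>2 * (y3 \<bullet> z3))"
      by (simp add: fun_eq_iff kruskal_metric_eq)
    show ?thesis
      unfolding eq by (auto intro!: derivative_eq_intros K R simp: r_def[symmetric] fun_eq_iff field_simps)
  qed
  from fun_cong[OF frechet_derivative_at[OF this], of "(a, b, c)"] show ?thesis
    by (simp add: metric_deriv_def \<kappa>_def \<sigma>_def)
qed

text \<open>Linearity in the last argument is what makes the Koszul form representable by a
  vector.\<close>

lemma koszul_form_kruskal_linear:
  assumes "M > 0" and "p \<in> kruskal M"
  shows "linear (koszul_form (kruskal_metric M) p x Y)"
proof -
  obtain U V \<omega> where p: "p = (U, V, \<omega>)" by (cases p)
  obtain x1 x2 x3 where x: "x = (x1, x2, x3)" by (cases x)
  obtain n1 n2 n3 where n: "Y (U, V, \<omega>) = (n1, n2, n3)" by (cases "Y (U, V, \<omega>)")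
  obtain y1 y2 y3 where y: "frechet_derivative Y (at (U, V, \<omega>)) (x1, x2, x3) = (y1, y2, y3)"
    by (cases "frechet_derivative Y (at (U, V, \<omega>)) (x1, x2, x3)")
  note deriv = metric_deriv_kruskal[OF assms(1) assms(2)[unfolded p]]
  show ?thesis
    unfolding p x
  proof (rule linearI)
    fix b1 b2 :: event
    show "koszul_form (kruskal_metric M) (U, V, \<omega>) (x1, x2, x3) Y (b1 + b2) =
      koszul_form (kruskal_metric M) (U, V, \<omega>) (x1, x2, x3) Y b1 +
      koszul_form (kruskal_metric M) (U, V, \<omega>) (x1, x2, x3) Y b2"
      by (cases b1; cases b2)
        (simp add: koszul_form_def n y deriv kruskal_metric_eq inner_add_right algebra_simps
          add_divide_distrib diff_divide_distrib)
  next
    fix c :: real and b :: event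
    show "koszul_form (kruskal_metric M) (U, V, \<omega>) (x1, x2, x3) Y (c *\<^sub>R b) =
      c *\<^sub>R koszul_form (kruskal_metric M) (U, V, \<omega>) (x1, x2, x3) Y b"
      by (cases b)
        (simp add: koszul_form_def n y deriv kruskal_metric_eq algebra_simps
          add_divide_distrib diff_divide_distrib)
  qed
qed

text \<open>Shows that the \<open>THE\<close> in \<open>levi_civita\<close> denotes: the metric is
  nondegenerate on each tangent space, so the Koszul form has a unique representing vector
  there.\<close>

lemma kruskal_metric_levi_civita:
  assumes M: "M > 0" and p: "p \<in> kruskal M" and z: "z \<in> tangent_space (kruskal M) p"
  shows "kruskal_metric M p (levi_civita (kruskal M) (kruskal_metric M) p x Y) z =
    koszul_form (kruskal_metric M) p x Y z"
proof -
  obtain U V \<omega> where p_eq: "p = (U, V, \<omega>)" by (cases p)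
  define \<phi> where "\<phi> = koszul_form (kruskal_metric M) p x Y"
  have lin: "linear \<phi>"
    using koszul_form_kruskal_linear[OF M p] by (simp add: \<phi>_def)
  define r where "r = radius M U V"
  define k where "k = kruskal_factor M r"
  have \<omega>: "\<omega> \<bullet> \<omega> = 1" and UV: "U * V > - 2 * M"
    using p by (auto simp: p_eq kruskal_def norm_eq_1)
  have r: "r > 0" unfolding r_def by (rule radius_pos[OF M UV])
  have k: "k > 0" using M r by (simp add: k_def kruskal_factor_def)
  have g: "kruskal_metric M p (a, b, w) (a', b', w') = k * ((a * b' + b * a') / 2) + r\<^sup>2 * (w \<bullet> w')"
    for a b w a' b' w' by (simp add: p_eq kruskal_metric_eq k_def r_def)
  have T: "(a, b, w) \<in> tangent_space (kruskal M) p \<longleftrightarrow> w \<bullet> \<omega> = 0" for a b w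
    using tangent_space_kruskal p by (simp add: p_eq)
  define L where "L = (\<Sum>i\<in>Basis. \<phi> (0, 0, i) *\<^sub>R i)"
  have L: "\<phi> (0, 0, c) = L \<bullet> c" for c
  proof -
    have "linear (\<lambda>c. \<phi> (0, 0, c))"
      using linear_add[OF lin, of "(0, 0, _)" "(0, 0, _)"] linear_scale[OF lin, of _ "(0, 0, _)"]
      by (auto intro!: linearI)
    from linear_sum[OF this, of "\<lambda>i. (c \<bullet> i) *\<^sub>R i" Basis] linear_scale[OF this]
    have "\<phi> (0, 0, \<Sum>i\<in>Basis. (c \<bullet> i) *\<^sub>R i) = (\<Sum>i\<in>Basis. (c \<bullet> i) * \<phi> (0, 0, i))"
      by simp
    also have "\<dots> = L \<bullet> c"
      unfolding L_def inner_sum_left by (intro sum.cong) (auto simp: inner_commute)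
    finally show ?thesis by (simp only: euclidean_representation)
  qed
  define A where "A = \<phi> (1, 0, 0)"
  define B where "B = \<phi> (0, 1, 0)"
  have \<phi>: "\<phi> (a, b, c) = a * A + b * B + L \<bullet> c" for a b c
  proof -
    have "(a, b, c) = a *\<^sub>R (1, 0, 0) + b *\<^sub>R (0, 1, 0) + (0, 0, c)" by simp
    then show ?thesis by (simp only: linear_add[OF lin] linear_scale[OF lin] L A_def B_def) simp
  qed
  \<comment> \<open>Only the part of \<open>L\<close> orthogonal to \<open>\<omega>\<close> acts on
    tangent vectors; the division undoes the factor r^2 of the round metric.\<close>
  define l where "l = (L - (L \<bullet> \<omega>) *\<^sub>R \<omega>) /\<^sub>R r\<^sup>2"
  have l: "l \<bullet> \<omega> = 0" using \<omega> by (simp add: l_def inner_diff_left)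
  have l_inner: "r\<^sup>2 * (l \<bullet> c) = L \<bullet> c" if "c \<bullet> \<omega> = 0" for c
    using r that by (simp add: l_def inner_diff_left inner_diff_right inner_commute field_simps)
  \<comment> \<open>The (U, V) block pairs a with b' and b with a', each with weight k/2, so A and B
    change places and are multiplied by 2/k.\<close>
  define w where "w = (2 * B / k, 2 * A / k, l)"
  have w_T: "w \<in> tangent_space (kruskal M) p"
    by (simp add: w_def T l)
  have w_eq: "kruskal_metric M p w z = \<phi> z" if "z \<in> tangent_space (kruskal M) p" for z
  proof -
    have "k * ((2 * B / k * b + 2 * A / k * a) / 2) = a * A + b * B" for a b
      using k by (simp add: field_simps)
    then show ?thesis using that by (cases z) (auto simp: w_def T g \<phi> l_inner)
  qed
  have "levi_civita (kruskal M) (kruskal_metric M) p x Y = w"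
    unfolding levi_civita_def \<phi>_def[symmetric]
  proof (rule the_equality)
    show "w \<in> tangent_space (kruskal M) p \<and>
      (\<forall>z\<in>tangent_space (kruskal M) p. kruskal_metric M p w z = \<phi> z)"
      using w_T w_eq by blast
  next
    fix w' assume w': "w' \<in> tangent_space (kruskal M) p \<and>
      (\<forall>z\<in>tangent_space (kruskal M) p. kruskal_metric M p w' z = \<phi> z)"
    obtain a b c where abc: "w' = (a, b, c)" by (cases w')
    have c: "c \<bullet> \<omega> = 0" using w' by (simp add: abc T)
    have eq: "kruskal_metric M p (a, b, c) (a', b', c') = \<phi> (a', b', c')" if "c' \<bullet> \<omega> = 0" for a' b' c'
      using w' that by (simp add: abc T)
    \<comment> \<open>Uniqueness is tested on the difference itself: \<open>c - l\<close> is tangent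
      to the sphere, where the metric is positive definite.\<close>
    have d: "(c - l) \<bullet> \<omega> = 0" using c l by (simp add: inner_diff_left)
    have "r\<^sup>2 * (c \<bullet> (c - l)) = r\<^sup>2 * (l \<bullet> (c - l))"
      using eq[OF d, of 0 0] by (simp add: g \<phi> l_inner[OF d])
    then have "r\<^sup>2 * ((c - l) \<bullet> (c - l)) = 0"
      by (simp add: inner_diff_left algebra_simps)
    then have "c = l" using r by simp
    moreover have "k * b = 2 * A" "k * a = 2 * B"
      using eq[of 0 1 0] eq[of 0 0 1] by (simp_all add: g \<phi>)
    ultimately show "w' = w" using k by (simp add: abc w_def field_simps)
  qed
  then show ?thesis using w_eq[OF z] by (simp add: \<phi>_def)
qed

section \<open>The curve through the bifurcation sphere\<close>

locale schwarzschild =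
  fixes M H :: real
  assumes M_pos: "M > 0"
begin

text \<open>
  The parameter \<open>s\<close> is a signed square root of \<open>r - 2M\<close>, positive in region I and negative in
  region I'. With \<open>c = -8M\<^sup>3H\<close> the factor \<open>r - 2M\<close> of \<open>Hr + c/r\<^sup>2\<close> cancels the zero of \<open>h\<close>, so that
  \<open>dt/ds\<close> becomes the function \<open>slope\<close>, smooth through \<open>s = 0\<close>.
\<close>

definition rad :: "real \<Rightarrow> real" where "rad s = 2 * M + s\<^sup>2"
text \<open>The cofactor in r^3 - 8M^3 = (r - 2M) \<open>pol s\<close>, where r =
  \<open>rad s\<close>. For s > 0 this yields Hr + c/r^2 = s \<open>num s\<close> / r^2 and 1 + l1^2
  = \<open>disc s\<close> / r^3.\<close>

definition pol :: "real \<Rightarrow> real" where "pol s = (rad s)\<^sup>2 + 2 * M * rad s + 4 * M\<^sup>2"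
definition num :: "real \<Rightarrow> real" where "num s = H * s * pol s"
definition disc :: "real \<Rightarrow> real" where "disc s = rad s ^ 3 + (num s)\<^sup>2"
definition den :: "real \<Rightarrow> real" where "den s = sqrt (disc s)"
definition slope :: "real \<Rightarrow> real" where "slope s = 2 * H * pol s * rad s / den s"

lemma rad_pos: "rad s > 0"
  using M_pos by (simp add: rad_def add_pos_nonneg)

lemma disc_pos: "disc s > 0"
  using rad_pos by (simp add: disc_def add_pos_nonneg)

lemma den_pos: "den s > 0"
  using disc_pos by (simp add: den_def)

lemma den_power2: "(den s)\<^sup>2 = rad s ^ 3 + (num s)\<^sup>2"
  using disc_pos[of s] by (simp add: den_def disc_def)

text \<open>The source of spacelikeness: the velocity components of the curve carry the factors
  \<open>den s - num s\<close> and \<open>den s + num s\<close>, which must both be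
  positive.\<close>

lemma num_less_den: "\<bar>num s\<bar> < den s"
proof -
  have "\<bar>num s\<bar>\<^sup>2 < (den s)\<^sup>2" using rad_pos by (simp add: den_power2)
  then show ?thesis using den_pos[of s] by (meson less_imp_le power_less_imp_less_base)
qed

lemma smooth_rad: "smooth_on UNIV rad"
  unfolding rad_def[abs_def] by (intro smooth_on_intros)

lemma smooth_disc: "smooth_on UNIV disc"
  unfolding disc_def[abs_def] num_def pol_def by (intro smooth_on_intros smooth_rad)

lemma smooth_slope: "smooth_on UNIV slope"
proof -
  have "slope = (\<lambda>s. 2 * H * pol s * rad s * disc s powr (- (1 / 2)))"
    using disc_pos by (simp add: fun_eq_iff slope_def den_def powr_minus powr_half_sqrt less_imp_le field_simps)
  then show ?thesis
    unfolding pol_def by (auto intro!: smooth_on_intros smooth_on_powr smooth_rad smooth_disc disc_pos)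
qed

lemma slope_antiderivative: "\<exists>F. (\<forall>s. (F has_real_derivative slope s) (at s)) \<and> F s\<^sub>0 = b"
proof -
  have "isCont slope s" for s
    using smooth_slope by (auto simp: smooth_on_def continuous_on_eq_continuous_at dest!: spec[of _ 0])
  then obtain F where F: "\<And>s. (F has_vector_derivative slope s) (at s)"
    using einterval_antiderivative[of "-\<infinity>" "\<infinity>" slope] by auto
  have "((\<lambda>s. F s - F s\<^sub>0 + b) has_real_derivative slope s) (at s)" for s
    using F[of s] by (auto intro!: derivative_eq_intros simp: has_real_derivative_iff_has_vector_derivative)
  then show ?thesis by (intro exI[of _ "\<lambda>s. F s - F s\<^sub>0 + b"]) simp
qed

text \<open>The substitution x = 2M + s^2, dx = 2s ds: the left side is dt/dx, while
  \<open>slope\<close> is dt/ds.\<close>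

lemma l1_integrand:
  assumes x: "x > 2 * M" and c: "c = - 8 * M ^ 3 * H"
  shows "l1 M H c x / schwarzschild_h M x * (1 / sqrt (1 + (l1 M H c x)\<^sup>2)) =
    slope (sqrt (x - 2 * M)) / (2 * sqrt (x - 2 * M))"
proof -
  define s where "s = sqrt (x - 2 * M)"
  have s: "s > 0" "s\<^sup>2 = x - 2 * M" using x by (simp_all add: s_def)
  have x_pos: "x > 0" using x M_pos by linarith
  have rad: "rad s = x" by (simp add: rad_def s)
  have h: "schwarzschild_h M x = s\<^sup>2 / x"
    using x_pos by (simp add: schwarzschild_h_def s field_simps)
  have "H * x + c / x\<^sup>2 = s * num s / x\<^sup>2"
  proof -
    have "H * (x ^ 3 - 8 * M ^ 3) = H * (s\<^sup>2 * pol s)"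
      unfolding s(2) pol_def rad by (simp add: power2_eq_square power3_eq_cube algebra_simps)
    then show ?thesis
      using x_pos by (simp add: c num_def field_simps power2_eq_square power3_eq_cube)
  qed
  then have l: "l1 M H c x = num s * sqrt x / x\<^sup>2"
    using s(1) x_pos by (simp add: l1_def h real_sqrt_divide power2_eq_square)
  have "1 + (l1 M H c x)\<^sup>2 = disc s / x ^ 3"
    using x_pos by (simp add: l disc_def rad power_divide power_mult_distrib field_simps power2_eq_square power3_eq_cube)
  moreover have "sqrt (x ^ 3) = x * sqrt x"
    using x_pos by (simp add: power3_eq_cube real_sqrt_mult)
  ultimately have root: "sqrt (1 + (l1 M H c x)\<^sup>2) = den s / (x * sqrt x)"
    by (simp add: real_sqrt_divide den_def)
  have "l1 M H c x / schwarzschild_h M x * (1 / sqrt (1 + (l1 M H c x)\<^sup>2)) =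
      (sqrt x * sqrt x) * num s / (s\<^sup>2 * den s)"
    unfolding root unfolding l h using s(1) x_pos den_pos[of s]
    by (simp add: field_simps power2_eq_square)
  also have "\<dots> = slope s / (2 * s)"
    using s(1) x_pos den_pos[of s] by (simp add: slope_def num_def rad field_simps power2_eq_square)
  finally show ?thesis by (simp add: s_def)
qed

end

text \<open>
  The radial principal curvature: the first two terms come from the derivative of the unit normal
  along the unit tangent, the third one from the derivative of the metric along the normal.
\<close>

lemma radial_curvature_identity:
  fixes M H r :: real
  assumes "M > 0" and "r > 0"
  defines "P \<equiv> r\<^sup>2 + 2 * M * r + 4 * M\<^sup>2"
  shows "H * P / (4 * M * r) + H * (P * r + 4 * (r - 2 * M) * r * (r + M) - 3 * (r - 2 * M) * P) / (2 * r ^ 3)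
     - 1 / 2 * (H * (r - 2 * M) * P / r\<^sup>2) * (1 / (2 * M) + 1 / r) = H + 16 * H * M ^ 3 / r ^ 3"
  using assms(1,2) unfolding P_def
  by (simp add: divide_simps) (simp add: power2_eq_square power3_eq_cube algebra_simps)

locale glued_curve = schwarzschild +
  fixes F :: "real \<Rightarrow> real"
  assumes F_deriv: "\<And>s. (F has_real_derivative slope s) (at s)"
begin

text \<open>The exponents meet two requirements: UV = s^2 exp(r/2M), so that the radius is
  \<open>rad s\<close>, and V/U = exp(F/2M) for s \<noteq> 0, so that t = F(s).\<close>

definition U :: "real \<Rightarrow> real" where "U s = s * exp (rad s / (4 * M) - F s / (4 * M))"
definition V :: "real \<Rightarrow> real" where "V s = s * exp (rad s / (4 * M) + F s / (4 * M))"

text \<open>\<open>(eU, eV, 0)\<close> is the unit tangent of the curve, and \<open>(-eU, eV, 0)\<close> its future unit normal.\<close>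

definition eU :: "real \<Rightarrow> real" where
  "eU s = exp (rad s / (4 * M) - F s / (4 * M)) * (den s - num s) / (4 * M * rad s)"
definition eV :: "real \<Rightarrow> real" where
  "eV s = exp (rad s / (4 * M) + F s / (4 * M)) * (den s + num s) / (4 * M * rad s)"
text \<open>Length of the velocity: (U', V') is \<open>speed\<close> times (eU, eV).\<close>

definition speed :: "real \<Rightarrow> real" where "speed s = 2 * (rad s)\<^sup>2 / den s"

definition X :: "real \<Rightarrow> real" where "X s = (U s + V s) / 2"
definition T :: "real \<Rightarrow> real" where "T s = (V s - U s) / 2"
definition XD :: "real \<Rightarrow> real" where "XD s = speed s * (eU s + eV s) / 2"
definition TD :: "real \<Rightarrow> real" where "TD s = speed s * (eV s - eU s) / 2"
definition par :: "real \<Rightarrow> real" where "par = inv X"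

lemma rad_deriv: "(rad has_real_derivative 2 * s) (at s)"
  unfolding rad_def[abs_def] by (auto intro!: derivative_eq_intros)

lemma speed_pos: "speed s > 0"
  using rad_pos[of s] den_pos[of s] by (simp add: speed_def)

lemma speed_neq_0: "speed s \<noteq> 0"
  using speed_pos[of s] by simp

lemma eU_pos: "eU s > 0" and eV_pos: "eV s > 0"
  using num_less_den[of s] rad_pos[of s] M_pos by (simp_all add: eU_def eV_def)

lemma XD_pos: "XD s > 0"
  using speed_pos[of s] eU_pos[of s] eV_pos[of s] by (simp add: XD_def)

lemma U_deriv: "(U has_real_derivative speed s * eU s) (at s)"
proof -
  define E where "E = exp (rad s / (4 * M) - F s / (4 * M))"
  have "(U has_real_derivative E + s * (E * (2 * s / (4 * M) - slope s / (4 * M)))) (at s)"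
    unfolding U_def[abs_def] E_def
    by (auto intro!: derivative_eq_intros rad_deriv F_deriv simp: M_pos[THEN less_imp_neq, symmetric])
  moreover have "E + s * (E * (2 * s / (4 * M) - slope s / (4 * M))) =
      E * ((4 * M + 2 * s\<^sup>2) - s * slope s) / (4 * M)"
    using M_pos by (simp add: field_simps power2_eq_square)
  \<comment> \<open>With the next identity, 2 \<open>rad s\<close> factors out of the bracket and
    leaves (den - num)/den; no factor s remains, so the velocity does not vanish at s = 0.\<close>
  moreover have "4 * M + 2 * s\<^sup>2 = 2 * rad s" by (simp add: rad_def)
  moreover have "s * slope s = 2 * rad s * num s / den s" by (simp add: slope_def num_def)
  moreover have "E * (2 * rad s - 2 * rad s * num s / den s) / (4 * M) = speed s * eU s"
    using M_pos rad_pos[of s] den_pos[of s]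
    by (simp add: speed_def eU_def E_def field_simps power2_eq_square)
  ultimately show ?thesis by simp
qed

lemma V_deriv: "(V has_real_derivative speed s * eV s) (at s)"
proof -
  define E where "E = exp (rad s / (4 * M) + F s / (4 * M))"
  have "(V has_real_derivative E + s * (E * (2 * s / (4 * M) + slope s / (4 * M)))) (at s)"
    unfolding V_def[abs_def] E_def
    by (auto intro!: derivative_eq_intros rad_deriv F_deriv simp: M_pos[THEN less_imp_neq, symmetric])
  moreover have "E + s * (E * (2 * s / (4 * M) + slope s / (4 * M))) =
      E * ((4 * M + 2 * s\<^sup>2) + s * slope s) / (4 * M)"
    using M_pos by (simp add: field_simps power2_eq_square)
  moreover have "4 * M + 2 * s\<^sup>2 = 2 * rad s" by (simp add: rad_def)
  moreover have "s * slope s = 2 * rad s * num s / den s" by (simp add: slope_def num_def)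
  moreover have "E * (2 * rad s + 2 * rad s * num s / den s) / (4 * M) = speed s * eV s"
    using M_pos rad_pos[of s] den_pos[of s]
    by (simp add: speed_def eV_def E_def field_simps power2_eq_square)
  ultimately show ?thesis by simp
qed

lemma X_deriv: "(X has_real_derivative XD s) (at s)"
  unfolding X_def[abs_def] XD_def
  by (auto intro!: derivative_eq_intros U_deriv V_deriv simp: field_simps)

lemma T_deriv: "(T has_real_derivative TD s) (at s)"
  unfolding T_def[abs_def] TD_def
  by (auto intro!: derivative_eq_intros U_deriv V_deriv simp: field_simps)

lemma exp_mult_exp:
  "exp (rad s / (4 * M) - F s / (4 * M)) * exp (rad s / (4 * M) + F s / (4 * M)) = exp (rad s / (2 * M))"
  unfolding exp_add[symmetric] using M_pos by (simp add: field_simps)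

lemma U_mult_V: "U s * V s = s\<^sup>2 * exp (rad s / (2 * M))"
  using exp_mult_exp[of s] by (simp add: U_def V_def power2_eq_square)

lemma radius_UV: "radius M (U s) (V s) = rad s"
  by (rule radius_eqI[OF M_pos rad_pos]) (simp add: U_mult_V rad_def)

text \<open>Surjectivity needs no control of F: X = s exp(r/4M) cosh(F/4M), and both factors after s
  are at least 1, so |X(s)| \<ge> |s|.\<close>

lemma bij_X: "bij X"
proof (rule bijI)
  have "X a < X b" if "a < b" for a b
    using DERIV_pos_imp_increasing[OF that] X_deriv XD_pos by blast
  then show "inj X" by (metis injI linorder_cases order_less_irrefl)
  have X: "X s = s * (exp (rad s / (4 * M)) * cosh (F s / (4 * M)))" for s
    by (simp add: X_def U_def V_def cosh_def exp_add exp_diff exp_minus field_simps)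
  have large: "exp (rad s / (4 * M)) * cosh (F s / (4 * M)) \<ge> 1" for s
    using mult_mono[of 1 "exp (rad s / (4 * M))" 1 "cosh (F s / (4 * M))"] rad_pos[of s] M_pos cosh_real_ge_1
    by simp
  show "surj X"
    unfolding surj_def
  proof
    fix x
    have "\<bar>x\<bar> \<le> X \<bar>x\<bar>"
      unfolding X using mult_left_mono[OF large[of "\<bar>x\<bar>"], of "\<bar>x\<bar>"] by simp
    moreover have "X (- \<bar>x\<bar>) \<le> - \<bar>x\<bar>"
      unfolding X using mult_left_mono[OF large[of "- \<bar>x\<bar>"], of "\<bar>x\<bar>"] by simp
    moreover have "continuous_on {- \<bar>x\<bar>..\<bar>x\<bar>} X"
      using X_deriv DERIV_isCont by (auto intro!: continuous_at_imp_continuous_on)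
    ultimately have "\<exists>s\<ge>- \<bar>x\<bar>. s \<le> \<bar>x\<bar> \<and> X s = x"
      by (intro IVT') auto
    then show "\<exists>s. x = X s" by metis
  qed
qed

lemma X_par: "X (par x) = x" and par_X: "par (X s) = s"
  using bij_X by (simp_all add: par_def bij_is_surj surj_f_inv_f bij_is_inj)

lemma par_deriv: "(par has_real_derivative 1 / XD (par x)) (at x)"
proof -
  have "isCont par (X (par x))"
    by (rule isCont_inverse_function2[of "par x - 1" _ "par x + 1"])
      (auto simp: par_X intro!: DERIV_isCont[OF X_deriv])
  then have "isCont par x" by (simp add: X_par)
  then have "(par has_real_derivative inverse (XD (par x))) (at x)"
    by - (rule DERIV_inverse_function[where f = X and a = "x - 1" and b = "x + 1"],
      use XD_pos[of "par x"] in \<open>auto simp: X_par intro: X_deriv\<close>)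
  then show ?thesis by (simp add: field_simps)
qed

section \<open>The surface as a level set and its tangent spaces\<close>

definition defining :: "event \<Rightarrow> real" where
  "defining q = (fst (snd q) - fst q) / 2 - T (par ((fst q + fst (snd q)) / 2))"

text \<open>\<open>defining\<close> is T - phi(X) with phi the composite of \<open>T\<close> and
  \<open>par\<close>. It lives on the whole Euclidean space and avoids \<open>radius\<close>, so
  only functions of one variable matter; the delicate one is \<open>par\<close>.\<close>

lemma smooth_defining: "smooth_on UNIV defining"
proof -
  have F: "smooth_on UNIV F"
    using smooth_on_real_antiderivative[OF F_deriv] smooth_slope by blast
  have UV: "smooth_on UNIV U" "smooth_on UNIV V"
    unfolding U_def[abs_def] V_def[abs_def] by (intro smooth_on_intros smooth_rad F)+
  have X: "smooth_on UNIV X" and T: "smooth_on UNIV T"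
    unfolding X_def[abs_def] T_def[abs_def] by (intro smooth_on_intros UV)+
  have "smooth_on UNIV XD"
    using smooth_on_real_antiderivative[OF X_deriv] X by blast
  \<comment> \<open>The inverse of X satisfies par' = g(par) with g = 1/XD, an autonomous equation
    with smooth g.\<close>
  then have "smooth_on UNIV (\<lambda>s. XD s powr - 1)"
    using XD_pos by (intro smooth_on_powr)
  moreover have "(par has_real_derivative XD (par x) powr - 1) (at x)" for x
    using par_deriv[of x] XD_pos[of "par x"] by (simp add: powr_minus_divide)
  ultimately have par: "smooth_on UNIV par"
    by (rule smooth_on_autonomous_ode)
  have fst: "smooth_on UNIV (\<lambda>q::event. fst q)" and snd: "smooth_on UNIV (\<lambda>q::event. fst (snd q))"
    by (auto intro!: smooth_on_bounded_linear bounded_linear_fst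
        bounded_linear_compose[OF bounded_linear_fst bounded_linear_snd])
  show ?thesis
    unfolding defining_def[abs_def]
    by (intro smooth_on_intros smooth_on_compose[OF T] smooth_on_compose[OF par] fst snd)
qed

lemma par_event_deriv:
  "((\<lambda>q::event. par ((fst q + fst (snd q)) / 2)) has_derivative
     (\<lambda>v. (fst v + fst (snd v)) / 2 / XD s)) (at (U s, V s, \<omega>))"
proof -
  have "((\<lambda>q::event. (fst q + fst (snd q)) / 2) has_derivative (\<lambda>v. (fst v + fst (snd v)) / 2)) (at (U s, V s, \<omega>))"
    by (auto intro!: derivative_eq_intros)
  from DERIV_compose_FDERIV[OF par_deriv this] show ?thesis
    by (simp add: X_def[symmetric] par_X)
qed

lemma defining_deriv:
  "(defining has_derivative (\<lambda>v. (fst (snd v) - fst v) / 2 - (fst v + fst (snd v)) / 2 * TD s / XD s))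
     (at (U s, V s, \<omega>))"
proof -
  have "((\<lambda>q::event. T (par ((fst q + fst (snd q)) / 2))) has_derivative
     (\<lambda>v. (fst v + fst (snd v)) / 2 / XD s * TD s)) (at (U s, V s, \<omega>))"
    using DERIV_compose_FDERIV[OF T_deriv par_event_deriv[of s \<omega>]] by (simp add: X_def[symmetric] par_X)
  then show ?thesis
    unfolding defining_def[abs_def] by (auto intro!: derivative_eq_intros)
qed

definition surface :: "event set" where
  "surface = {(U s, V s, \<omega>) | s \<omega>. norm \<omega> = 1}"

lemma surface_subset: "surface \<subseteq> kruskal M"
proof -
  have "U s * V s > - 2 * M" for s
    unfolding U_mult_V using M_pos
    by (smt (verit) exp_ge_zero mult_nonneg_nonneg zero_le_power2)
  then show ?thesis by (auto simp: surface_def kruskal_def)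
qed

lemma surface_eq: "surface = {q \<in> kruskal M. defining q = 0}"
proof (intro Set.set_eqI iffI)
  fix q assume q: "q \<in> surface"
  then obtain s \<omega> where "q = (U s, V s, \<omega>)" by (auto simp: surface_def)
  then have "defining q = 0" by (simp add: defining_def X_def[symmetric] par_X T_def)
  then show "q \<in> {q \<in> kruskal M. defining q = 0}" using q surface_subset by blast
next
  fix q assume q: "q \<in> {q \<in> kruskal M. defining q = 0}"
  obtain a b \<omega> where abc: "q = (a, b, \<omega>)" by (cases q)
  define s where "s = par ((a + b) / 2)"
  have "X s = (a + b) / 2" by (simp add: s_def X_par)
  moreover have "T s = (b - a) / 2" using q by (simp add: abc defining_def s_def)
  ultimately have "a = U s" "b = V s" by (auto simp: X_def T_def)
  then show "q \<in> surface" using q by (auto simp: abc surface_def kruskal_def)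
qed

text \<open>A velocity lies in the kernel of the derivative of \<open>defining\<close>, which fixes
  the ratio of a and b; conversely, moving along the curve and the sphere at once realises each such
  vector.\<close>

lemma tangent_space_surface:
  assumes "norm \<omega> = 1"
  shows "tangent_space surface (U s, V s, \<omega>) = {(x * eU s, x * eV s, w) | x w. w \<bullet> \<omega> = 0}"
proof (intro equalityI subsetI)
  fix v assume "v \<in> tangent_space surface (U s, V s, \<omega>)"
  then obtain \<gamma> where \<gamma>: "\<And>t. \<gamma> t \<in> surface" "\<gamma> 0 = (U s, V s, \<omega>)" "(\<gamma> has_vector_derivative v) (at 0)"
    by (auto simp: tangent_space_def)
  obtain a b w where v: "v = (a, b, w)" by (cases v)
  have "v \<in> tangent_space (kruskal M) (U s, V s, \<omega>)"
    using \<gamma> surface_subset by (auto simp: tangent_space_def)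
  moreover have K: "(U s, V s, \<omega>) \<in> kruskal M"
    using assms surface_subset by (auto simp: surface_def)
  ultimately have w: "w \<bullet> \<omega> = 0" using tangent_space_kruskal v by blast
  have "defining (\<gamma> t) = 0" for t using \<gamma>(1) surface_eq by blast
  moreover have "((\<lambda>t. defining (\<gamma> t)) has_derivative
      (\<lambda>h. h * ((b - a) / 2 - (a + b) / 2 * TD s / XD s))) (at 0)"
    by (rule has_derivative_eq_rhs[OF has_derivative_compose[OF \<gamma>(3)[unfolded has_vector_derivative_def]
          defining_deriv[of s \<omega>, folded \<gamma>(2)]]])
      (simp add: v fun_eq_iff field_simps)
  ultimately have "((\<lambda>t::real. 0) has_derivative (\<lambda>h. h * ((b - a) / 2 - (a + b) / 2 * TD s / XD s))) (at 0)"
    by simp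
  from fun_cong[OF has_derivative_unique[OF this has_derivative_const], of 1]
  have *: "(b - a) / 2 = (a + b) / 2 * TD s / XD s" by simp
  define x where "x = (a + b) / (eU s + eV s)"
  have pos: "eU s + eV s > 0" using eU_pos[of s] eV_pos[of s] by simp
  have ratio: "TD s / XD s = (eV s - eU s) / (eU s + eV s)"
    using speed_pos[of s] pos by (simp add: TD_def XD_def)
  have "a + b = x * (eU s + eV s)" using pos by (simp add: x_def)
  moreover have "b - a = x * (eV s - eU s)"
  proof -
    have "(b - a) / 2 = (a + b) / 2 * ((eV s - eU s) / (eU s + eV s))"
      using * by (simp only: times_divide_eq_right[symmetric] ratio)
    then have "b - a = (a + b) * ((eV s - eU s) / (eU s + eV s))"
      by (metis divide_cancel_right times_divide_eq_left zero_neq_numeral)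
    then show ?thesis by (simp add: x_def)
  qed
  ultimately have "a = x * eU s" "b = x * eV s" by (simp_all add: algebra_simps)
  then show "v \<in> {(x * eU s, x * eV s, w) | x w. w \<bullet> \<omega> = 0}" using w v by blast
next
  fix v assume "v \<in> {(x * eU s, x * eV s, w) | x w. w \<bullet> \<omega> = 0}"
  then obtain x w where v: "v = (x * eU s, x * eV s, w)" "w \<bullet> \<omega> = 0" by blast
  obtain c where c: "\<And>t. norm (c t) = 1" "c 0 = \<omega>" "(c has_vector_derivative w) (at 0)"
    using sphere_curve_exists[OF assms v(2)] by metis
  \<comment> \<open>The rate x / speed compensates for (U', V') being \<open>speed\<close> times the
    unit tangent.\<close>
  define l where "l t = s + t * (x / speed s)" for t
  have l: "(l has_real_derivative x / speed s) (at 0)" "l 0 = s"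
    unfolding l_def[abs_def] by (auto intro!: derivative_eq_intros simp: speed_neq_0)
  have "((\<lambda>t. U (l t)) has_real_derivative x * eU s) (at 0)"
    using DERIV_chain2[OF U_deriv l(1)] by (simp add: l(2) speed_neq_0 mult_ac)
  moreover have "((\<lambda>t. V (l t)) has_real_derivative x * eV s) (at 0)"
    using DERIV_chain2[OF V_deriv l(1)] by (simp add: l(2) speed_neq_0 mult_ac)
  ultimately have "((\<lambda>t. (U (l t), V (l t), c t)) has_vector_derivative v) (at 0)"
    unfolding v by (intro has_vector_derivative_Pair c(3)) (simp_all add: has_real_derivative_iff_has_vector_derivative)
  moreover have "(U (l t), V (l t), c t) \<in> surface" for t
    using c(1) by (auto simp: surface_def)
  ultimately show "v \<in> tangent_space surface (U s, V s, \<omega>)"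
    unfolding tangent_space_def using l(2) c(2) by (intro CollectI exI[of _ "\<lambda>t. (U (l t), V (l t), c t)"]) auto
qed


subsection \<open>Mean curvature\<close>

text \<open>The normalisation of \<open>eU\<close> and \<open>eV\<close>: since den^2 - num^2 = r^3,
  the tangent (eU, eV, 0) has square 1 and the normal (-eU, eV, 0) has square -1.\<close>

lemma kruskal_factor_eU_eV: "kruskal_factor M (rad s) * (eU s * eV s) = 1"
proof -
  have "eU s * eV s = exp (rad s / (2 * M)) * ((den s)\<^sup>2 - (num s)\<^sup>2) / (4 * M * rad s)\<^sup>2"
    using exp_mult_exp[of s] by (simp add: eU_def eV_def power2_eq_square algebra_simps)
  also have "(den s)\<^sup>2 - (num s)\<^sup>2 = rad s ^ 3" by (simp add: den_power2)
  finally show ?thesis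
    using rad_pos[of s] M_pos
    by (simp add: kruskal_factor_def exp_minus field_simps power2_eq_square power3_eq_cube)
qed

lemma metric_surface:
  "kruskal_metric M (U s, V s, \<omega>) (a, b, w) (a', b', w') =
     kruskal_factor M (rad s) * ((a * b' + b * a') / 2) + (rad s)\<^sup>2 * (w \<bullet> w')"
  by (simp add: kruskal_metric_eq radius_UV)

lemma metric_tangent:
  "kruskal_metric M (U s, V s, \<omega>) (x * eU s, x * eV s, w) (x' * eU s, x' * eV s, w') =
     x * x' + (rad s)\<^sup>2 * (w \<bullet> w')"
proof -
  have "kruskal_factor M (rad s) * ((x * eU s * (x' * eV s) + x * eV s * (x' * eU s)) / 2) =
      x * x' * (kruskal_factor M (rad s) * (eU s * eV s))"
    by (simp add: algebra_simps)
  then show ?thesis by (simp add: metric_surface kruskal_factor_eU_eV)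
qed

lemma spacelike_surface: "spacelike (kruskal_metric M) surface"
  unfolding spacelike_def
proof (intro ballI impI)
  fix p v assume p: "p \<in> surface" and v: "v \<in> tangent_space surface p" "v \<noteq> 0"
  obtain s \<omega> where s: "p = (U s, V s, \<omega>)" "norm \<omega> = 1" using p by (auto simp: surface_def)
  obtain x w where x: "v = (x * eU s, x * eV s, w)"
    using v(1) tangent_space_surface[OF s(2)] s(1) by auto
  have "x \<noteq> 0 \<or> w \<noteq> 0" using v(2) x by (auto simp: zero_prod_def)
  then have "x * x + (rad s)\<^sup>2 * (w \<bullet> w) > 0"
    using rad_pos[of s]
    by (smt (verit) inner_gt_zero_iff inner_ge_zero mult_pos_pos not_real_square_gt_zero
        zero_le_mult_iff zero_less_power)
  then show "kruskal_metric M p v v > 0" by (simp add: s x metric_tangent)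
qed

definition normal :: "event \<Rightarrow> event" where
  "normal q = (let s = par ((fst q + fst (snd q)) / 2) in (- eU s, eV s, 0))"

lemma normal_surface: "normal (U s, V s, \<omega>) = (- eU s, eV s, 0)"
  by (simp add: normal_def X_def[symmetric] par_X)

lemma normal_deriv:
  assumes "(eU has_real_derivative eU') (at s)" and "(eV has_real_derivative eV') (at s)"
  shows "(normal has_derivative (\<lambda>v. (- ((fst v + fst (snd v)) / 2 / XD s * eU'),
      (fst v + fst (snd v)) / 2 / XD s * eV', 0))) (at (U s, V s, \<omega>))"
proof -
  have par: "par ((fst (U s, V s, \<omega>) + fst (snd (U s, V s, \<omega>))) / 2) = s"
    by (simp add: X_def[symmetric] par_X)
  have "(eU has_real_derivative eU') (at (par ((fst (U s, V s, \<omega>) + fst (snd (U s, V s, \<omega>))) / 2)))"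
    "(eV has_real_derivative eV') (at (par ((fst (U s, V s, \<omega>) + fst (snd (U s, V s, \<omega>))) / 2)))"
    unfolding par by (fact assms)+
  then show ?thesis
    unfolding normal_def[abs_def] Let_def
    by (intro has_derivative_Pair has_derivative_minus has_derivative_const
        DERIV_compose_FDERIV[OF _ par_event_deriv])
qed

lemma future_unit_normal_surface:
  assumes "norm \<omega> = 1"
  shows "future_unit_normal (kruskal M) (kruskal_metric M) kruskal_dT surface (U s, V s, \<omega>)
    (normal (U s, V s, \<omega>))"
  unfolding future_unit_normal_def normal_surface
proof (intro conjI ballI)
  have "(U s, V s, \<omega>) \<in> kruskal M"
    using assms surface_subset by (auto simp: surface_def)
  then show "(- eU s, eV s, 0) \<in> tangent_space (kruskal M) (U s, V s, \<omega>)"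
    by (simp add: tangent_space_kruskal)
  show "kruskal_metric M (U s, V s, \<omega>) (- eU s, eV s, 0) v = 0"
    if "v \<in> tangent_space surface (U s, V s, \<omega>)" for v
    using that by (auto simp: tangent_space_surface[OF assms] metric_surface)
  show "kruskal_metric M (U s, V s, \<omega>) (- eU s, eV s, 0) (- eU s, eV s, 0) = - 1"
    using kruskal_factor_eU_eV[of s] by (simp add: metric_surface algebra_simps)
  have "kruskal_factor M (rad s) > 0" using rad_pos[of s] M_pos by (simp add: kruskal_factor_def)
  then have "kruskal_factor M (rad s) * (eU s + eV s) > 0"
    using eU_pos[of s] eV_pos[of s] by simp
  then show "kruskal_metric M (U s, V s, \<omega>) (- eU s, eV s, 0) (kruskal_dT (U s, V s, \<omega>)) < 0"
    by (simp add: metric_surface kruskal_dT_def algebra_simps)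
qed

definition num' :: "real \<Rightarrow> real" where
  "num' s = H * (pol s + 4 * s\<^sup>2 * (rad s + M))"

lemma num_deriv: "(num has_real_derivative num' s) (at s)"
  unfolding num_def[abs_def] pol_def num'_def
  by (auto intro!: derivative_eq_intros rad_deriv simp: algebra_simps power2_eq_square)

definition den' :: "real \<Rightarrow> real" where
  "den' s = (3 * (rad s)\<^sup>2 * s + num s * num' s) / den s"

lemma den_deriv: "(den has_real_derivative den' s) (at s)"
proof -
  have "(disc has_real_derivative 2 * (3 * (rad s)\<^sup>2 * s + num s * num' s)) (at s)"
    unfolding disc_def[abs_def]
    by (auto intro!: derivative_eq_intros rad_deriv num_deriv simp: algebra_simps)
  from DERIV_chain2[OF DERIV_real_sqrt[OF disc_pos] this] show ?thesis
    unfolding den_def[abs_def] den'_def by (rule DERIV_cong) (use disc_pos[of s] in \<open>simp add: field_simps\<close>)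
qed

lemma exp_mult_divide_rad_deriv:
  assumes "(f has_real_derivative f') (at s)" "(g has_real_derivative g') (at s)" "g s > 0"
  shows "((\<lambda>s. exp (f s) * g s / (4 * M * rad s)) has_real_derivative
    exp (f s) * g s / (4 * M * rad s) * (f' + g' / g s - 2 * s / rad s)) (at s)"
proof -
  have D: "((\<lambda>s. exp (f s) * g s) has_real_derivative exp (f s) * (f' * g s + g')) (at s)"
    using assms(1,2) by (auto intro!: derivative_eq_intros simp: algebra_simps)
  have R: "((\<lambda>s. 4 * M * rad s) has_real_derivative 4 * M * (2 * s)) (at s)"
    by (rule DERIV_cmult[OF rad_deriv])
  have "4 * M * rad s \<noteq> 0" using rad_pos[of s] M_pos by simp
  from DERIV_divide[OF D R this] show ?thesis
    by (rule DERIV_cong) (use rad_pos[of s] M_pos assms(3) in \<open>simp add: divide_simps algebra_simps\<close>)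
qed

text \<open>The left side is the product of the unit tangent with the derivative of the normal along
  it. As eU eV' - eV eU' is eU eV times the derivative of ln(eV/eU), the common factors of eU and eV
  drop out.\<close>

lemma unit_tangent_deriv:
  obtains eU' eV' where "(eU has_real_derivative eU') (at s)" and "(eV has_real_derivative eV') (at s)"
    and "kruskal_factor M (rad s) * (eU s * eV' - eV s * eU') / (2 * speed s) =
      H * pol s / (4 * M * rad s) + (num' s * rad s - 3 * s * num s) / (2 * rad s ^ 3)"
proof -
  define eU' where "eU' = eU s * (2 * s / (4 * M) - slope s / (4 * M) + (den' s - num' s) / (den s - num s) - 2 * s / rad s)"
  define eV' where "eV' = eV s * (2 * s / (4 * M) + slope s / (4 * M) + (den' s + num' s) / (den s + num s) - 2 * s / rad s)"
  have dn: "den s - num s > 0" "den s + num s > 0" using num_less_den[of s] by auto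
  note r = rad_pos[of s]
  have "(eU has_real_derivative eU') (at s)"
    unfolding eU_def[abs_def] eU'_def
    by (intro exp_mult_divide_rad_deriv DERIV_diff DERIV_cdivide rad_deriv F_deriv den_deriv num_deriv dn)
  moreover have "(eV has_real_derivative eV') (at s)"
    unfolding eV_def[abs_def] eV'_def
    by (intro exp_mult_divide_rad_deriv DERIV_add DERIV_cdivide rad_deriv F_deriv den_deriv num_deriv dn)
  moreover have "kruskal_factor M (rad s) * (eU s * eV' - eV s * eU') / (2 * speed s) =
      H * pol s / (4 * M * rad s) + (num' s * rad s - 3 * s * num s) / (2 * rad s ^ 3)"
  proof -
    have "eU s * eV' - eV s * eU' = eU s * eV s * (slope s / (2 * M)
        + ((den' s + num' s) / (den s + num s) - (den' s - num' s) / (den s - num s)))"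
      using M_pos by (simp add: eU'_def eV'_def algebra_simps)
    also have "(den' s + num' s) / (den s + num s) - (den' s - num' s) / (den s - num s) =
        2 * (num' s * den s - den' s * num s) / ((den s)\<^sup>2 - (num s)\<^sup>2)"
      using dn by (simp add: diff_frac_eq power2_eq_square algebra_simps)
    also have "(den s)\<^sup>2 - (num s)\<^sup>2 = rad s ^ 3" by (simp add: den_power2)
    \<comment> \<open>Inserting den den' = 3 r^2 s + num num' makes the terms in num^2 num'
      cancel.\<close>
    also have "num' s * den s - den' s * num s = (rad s)\<^sup>2 * (num' s * rad s - 3 * s * num s) / den s"
    proof -
      have "num' s * den s - den' s * num s =
          (num' s * (den s)\<^sup>2 - (3 * (rad s)\<^sup>2 * s + num s * num' s) * num s) / den s"
        using den_pos[of s] by (simp add: den'_def field_simps power2_eq_square)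
      also have "\<dots> = (rad s)\<^sup>2 * (num' s * rad s - 3 * s * num s) / den s"
        unfolding den_power2 by (simp add: algebra_simps power2_eq_square power3_eq_cube)
      finally show ?thesis .
    qed
    finally have "kruskal_factor M (rad s) * (eU s * eV' - eV s * eU') =
        (kruskal_factor M (rad s) * (eU s * eV s)) * (slope s / (2 * M)
          + 2 * ((rad s)\<^sup>2 * (num' s * rad s - 3 * s * num s) / den s) / rad s ^ 3)"
      by simp
    then have "kruskal_factor M (rad s) * (eU s * eV' - eV s * eU') / (2 * speed s) =
        (slope s / (2 * M) + 2 * ((rad s)\<^sup>2 * (num' s * rad s - 3 * s * num s) / den s) / rad s ^ 3) / (2 * speed s)"
      by (simp only: kruskal_factor_eU_eV mult_1)
    also have "\<dots> = H * pol s / (4 * M * rad s) + (num' s * rad s - 3 * s * num s) / (2 * rad s ^ 3)"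
      using r den_pos[of s] M_pos
      by (simp add: slope_def speed_def field_simps power2_eq_square power3_eq_cube)
    finally show ?thesis .
  qed
  ultimately show ?thesis using that by blast
qed

text \<open>
  The right-hand side is \<open>Hr + c/r\<^sup>2\<close>; divided by \<open>r\<close> it is the angular principal curvature.
\<close>

lemma normal_derivative_radius:
  "2 * M * exp (- rad s / (2 * M)) / rad s * (- eU s * V s + eV s * U s) = H * s\<^sup>2 * pol s / (rad s)\<^sup>2"
proof -
  have "- eU s * V s + eV s * U s = exp (rad s / (2 * M)) * (s * (2 * num s) / (4 * M * rad s))"
    using exp_mult_exp[of s] M_pos rad_pos[of s] by (simp add: eU_def eV_def U_def V_def field_simps)
  then show ?thesis
    using M_pos rad_pos[of s] by (simp add: num_def exp_minus field_simps power2_eq_square)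
qed

text \<open>There is no mixed term in x and w, and x^2 and r^2 |w|^2 are the squared lengths of the
  radial and angular parts; their coefficients are therefore the principal curvatures.\<close>

lemma koszul_form_normal:
  assumes "norm \<omega> = 1"
  shows "koszul_form (kruskal_metric M) (U s, V s, \<omega>) (x * eU s, x * eV s, w) normal (x * eU s, x * eV s, w) =
    (H + 16 * H * M ^ 3 / rad s ^ 3) * x\<^sup>2 + H * s\<^sup>2 * pol s / rad s ^ 3 * ((rad s)\<^sup>2 * (w \<bullet> w))"
proof -
  let ?e = "(x * eU s, x * eV s, w)"
  define r where "r = rad s"
  define k where "k = kruskal_factor M r"
  define \<nu> where "\<nu> = H * s\<^sup>2 * pol s / r\<^sup>2"
  have r: "r > 0" using rad_pos by (simp add: r_def)
  have K: "(U s, V s, \<omega>) \<in> kruskal M"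
    using assms surface_subset by (auto simp: surface_def)
  obtain eU' eV' where e': "(eU has_real_derivative eU') (at s)" "(eV has_real_derivative eV') (at s)"
    and radial: "k * (eU s * eV' - eV s * eU') / (2 * speed s) =
      H * pol s / (4 * M * r) + (num' s * r - 3 * s * num s) / (2 * r ^ 3)"
    using unit_tangent_deriv unfolding k_def r_def by blast
  have "frechet_derivative normal (at (U s, V s, \<omega>)) ?e =
      (- (x / speed s * eU'), x / speed s * eV', 0)"
  proof -
    have "(x * eU s + x * eV s) / 2 / XD s = x / speed s"
      using speed_pos[of s] eU_pos[of s] eV_pos[of s] by (simp add: XD_def distrib_left[symmetric])
    then show ?thesis using fun_cong[OF frechet_derivative_at[OF normal_deriv[OF e', of \<omega>]], of ?e] by simp
  qed
  then have first: "kruskal_metric M (U s, V s, \<omega>) (frechet_derivative normal (at (U s, V s, \<omega>)) ?e) ?e =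
      x\<^sup>2 * (k * (eU s * eV' - eV s * eU') / (2 * speed s))"
    using speed_pos[of s] by (simp add: metric_surface k_def r_def field_simps power2_eq_square)
  note md = metric_deriv_kruskal[OF M_pos K, unfolded radius_UV, folded r_def k_def]
  \<comment> \<open>By symmetry of the metric, two of the three derivative terms in the Koszul
    formula cancel; the derivative along the normal survives, at half weight.\<close>
  have sym: "metric_deriv (kruskal_metric M) (U s, V s, \<omega>) ?e (- eU s, eV s, 0) ?e =
      metric_deriv (kruskal_metric M) (U s, V s, \<omega>) ?e ?e (- eU s, eV s, 0)"
    by (simp add: md algebra_simps)
  have "metric_deriv (kruskal_metric M) (U s, V s, \<omega>) (- eU s, eV s, 0) ?e ?e =
      \<nu> * (2 * r * (w \<bullet> w) - (k * (eU s * eV s)) * x\<^sup>2 * (1 / (2 * M) + 1 / r))"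
  proof -
    have "k * \<sigma> * ((x * eU s * (x * eV s) + x * eV s * (x * eU s)) / 2) = (k * (eU s * eV s)) * x\<^sup>2 * \<sigma>" for \<sigma>
      by (simp add: power2_eq_square)
    then show ?thesis
      unfolding md normal_derivative_radius[of s, folded r_def, folded \<nu>_def] by (simp only:)
  qed
  then have second: "metric_deriv (kruskal_metric M) (U s, V s, \<omega>) (- eU s, eV s, 0) ?e ?e =
      \<nu> * (2 * r * (w \<bullet> w) - x\<^sup>2 * (1 / (2 * M) + 1 / r))"
    using kruskal_factor_eU_eV[of s] by (simp add: k_def r_def)
  have s2: "s\<^sup>2 = r - 2 * M" by (simp add: r_def rad_def)
  have num: "num' s * r - 3 * s * num s = H * (pol s * r + 4 * (r - 2 * M) * r * (r + M) - 3 * (r - 2 * M) * pol s)"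
    unfolding num'_def num_def s2[symmetric] r_def[symmetric] by (simp add: algebra_simps power2_eq_square)
  have pol: "pol s = r\<^sup>2 + 2 * M * r + 4 * M\<^sup>2" by (simp add: pol_def r_def)
  have total: "H * pol s / (4 * M * r) + (num' s * r - 3 * s * num s) / (2 * r ^ 3)
      - 1 / 2 * \<nu> * (1 / (2 * M) + 1 / r) = H + 16 * H * M ^ 3 / r ^ 3"
    unfolding num \<nu>_def s2 pol by (rule radial_curvature_identity[OF M_pos r])
  have "koszul_form (kruskal_metric M) (U s, V s, \<omega>) ?e normal ?e =
      x\<^sup>2 * (k * (eU s * eV' - eV s * eU') / (2 * speed s))
      + \<nu> * (2 * r * (w \<bullet> w) - x\<^sup>2 * (1 / (2 * M) + 1 / r)) / 2"
    unfolding koszul_form_def normal_surface first second sym by simp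
  also have "\<dots> = x\<^sup>2 * (H * pol s / (4 * M * r) + (num' s * r - 3 * s * num s) / (2 * r ^ 3)
      - 1 / 2 * \<nu> * (1 / (2 * M) + 1 / r)) + \<nu> * r * (w \<bullet> w)"
    unfolding radial by (simp add: algebra_simps diff_divide_distrib)
  also have "\<dots> = (H + 16 * H * M ^ 3 / r ^ 3) * x\<^sup>2 + H * s\<^sup>2 * pol s / r ^ 3 * (r\<^sup>2 * (w \<bullet> w))"
    unfolding total unfolding \<nu>_def using r by (simp add: power2_eq_square power3_eq_cube)
  finally show ?thesis by (simp add: r_def)
qed

text \<open>
  With \<open>e = (eU, eV, 0)\<close> and \<open>w\<close> orthogonal to \<open>\<omega>\<close>, the map \<open>x e + w \<mapsto> x \<omega> + r w\<close> is an isometry from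
  the tangent space onto \<open>\<real>\<^sup>3\<close>, which turns an orthonormal frame into an orthonormal basis.
\<close>

lemma orthonormal_frame_sums:
  assumes "norm \<omega> = 1" and "orthonormal_frame (kruskal_metric M) surface (U s, V s, \<omega>) e"
  obtains x w where "\<forall>i\<in>{1..3}. e i = (x i * eU s, x i * eV s, w i)"
    and "(\<Sum>i=1..3. (x i)\<^sup>2) = 1" and "(\<Sum>i=1..3. (rad s)\<^sup>2 * (w i \<bullet> w i)) = 2"
proof -
  have "\<forall>i\<in>{1..3}. \<exists>x w. e i = (x * eU s, x * eV s, w) \<and> w \<bullet> \<omega> = 0"
    using assms(2) tangent_space_surface[OF assms(1)] by (auto simp: orthonormal_frame_def)
  then obtain x w where e: "\<And>i. i \<in> {1..3} \<Longrightarrow> e i = (x i * eU s, x i * eV s, w i)"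
    and w: "\<And>i. i \<in> {1..3} \<Longrightarrow> w i \<bullet> \<omega> = 0"
    by metis
  have \<omega>: "\<omega> \<bullet> \<omega> = 1" using assms(1) by (simp add: norm_eq_1)
  have g: "x i * x j + (rad s)\<^sup>2 * (w i \<bullet> w j) = (if i = j then 1 else 0)"
    if "i \<in> {1..3}" "j \<in> {1..3}" for i j
    using assms(2) that e metric_tangent[of s \<omega> "x i" "w i" "x j" "w j"] by (simp add: orthonormal_frame_def)
  define v where "v i = x i *\<^sub>R \<omega> + rad s *\<^sub>R w i" for i
  have v: "v i \<bullet> v j = (if i = j then 1 else 0)" if "i \<in> {1..3}" "j \<in> {1..3}" for i j
  proof -
    have "w i \<bullet> \<omega> = 0" "\<omega> \<bullet> w j = 0"
      using w[OF that(1)] w[OF that(2)] by (simp_all add: inner_commute)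
    then have "v i \<bullet> v j = x i * x j + (rad s)\<^sup>2 * (w i \<bullet> w j)"
      by (simp add: v_def inner_add_left inner_add_right \<omega> power2_eq_square)
    then show ?thesis using g[OF that] by simp
  qed
  \<comment> \<open>The component of \<open>v i\<close> along \<open>\<omega>\<close> is
    \<open>x i\<close>, so Parseval for \<open>\<omega>\<close> gives the radial sum; of the total 3
    the angular sum keeps 2.\<close>
  have "(\<Sum>i=1..3. (x i)\<^sup>2) = (\<Sum>i=1..3. (v i \<bullet> \<omega>)\<^sup>2)"
  proof (rule sum.cong)
    show "(x i)\<^sup>2 = (v i \<bullet> \<omega>)\<^sup>2" if "i \<in> {1..3}" for i
      using w[OF that] by (simp add: v_def inner_add_left \<omega>)
  qed simp
  also have "\<dots> = \<omega> \<bullet> \<omega>"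
    by (rule orthonormal_sum_inner_power2) (rule v)
  finally have x: "(\<Sum>i=1..3. (x i)\<^sup>2) = 1" by (simp only: \<omega>)
  have "(\<Sum>i=1..3. (x i)\<^sup>2 + (rad s)\<^sup>2 * (w i \<bullet> w i)) = (\<Sum>i\<in>{1..3::nat}. 1)"
  proof (rule sum.cong)
    show "(x i)\<^sup>2 + (rad s)\<^sup>2 * (w i \<bullet> w i) = 1" if "i \<in> {1..3}" for i
      using g[OF that that] by (simp add: power2_eq_square)
  qed simp
  then have "(\<Sum>i=1..3. (rad s)\<^sup>2 * (w i \<bullet> w i)) = 2"
    unfolding sum.distrib x by simp
  then show ?thesis using that[of x w] e x by blast
qed

lemma has_mean_curvature_surface:
  assumes p: "p \<in> surface"
  shows "has_mean_curvature (kruskal M) (kruskal_metric M) kruskal_dT surface p H"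
  unfolding has_mean_curvature_def
proof (intro exI[of _ UNIV] exI[of _ normal] conjI allI impI ballI)
  fix q assume "q \<in> surface \<inter> UNIV"
  then show "future_unit_normal (kruskal M) (kruskal_metric M) kruskal_dT surface q (normal q)"
    using future_unit_normal_surface by (auto simp: surface_def)
next
  obtain s \<omega> where s: "p = (U s, V s, \<omega>)" "norm \<omega> = 1" using p by (auto simp: surface_def)
  obtain eU' eV' where e': "(eU has_real_derivative eU') (at s)" "(eV has_real_derivative eV') (at s)"
    using unit_tangent_deriv by blast
  show "normal differentiable at p"
    using normal_deriv[OF e'] unfolding s(1) differentiable_def by blast
  fix e assume e: "orthonormal_frame (kruskal_metric M) surface p e"
  obtain x w where xw: "\<forall>i\<in>{1..3}. e i = (x i * eU s, x i * eV s, w i)"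
    and sums: "(\<Sum>i=1..3. (x i)\<^sup>2) = 1" "(\<Sum>i=1..3. (rad s)\<^sup>2 * (w i \<bullet> w i)) = 2"
    by (rule orthonormal_frame_sums[OF s(2) e[unfolded s(1)]])
  have K: "p \<in> kruskal M" using p surface_subset by blast
  have T: "e i \<in> tangent_space (kruskal M) p" if "i \<in> {1..3}" for i
    using e that tangent_space_mono[OF surface_subset, of p] by (auto simp: orthonormal_frame_def)
  define \<nu> where "\<nu> = H * s\<^sup>2 * pol s / rad s ^ 3"
  have "(\<Sum>i=1..3. kruskal_metric M p (levi_civita (kruskal M) (kruskal_metric M) p (e i) normal) (e i)) =
     (\<Sum>i=1..3. (H + 16 * H * M ^ 3 / rad s ^ 3) * (x i)\<^sup>2 + \<nu> * ((rad s)\<^sup>2 * (w i \<bullet> w i)))"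
  proof (rule sum.cong)
    fix i :: nat assume i: "i \<in> {1..3}"
    have "e i = (x i * eU s, x i * eV s, w i)" using xw i by blast
    then show "kruskal_metric M p (levi_civita (kruskal M) (kruskal_metric M) p (e i) normal) (e i) =
        (H + 16 * H * M ^ 3 / rad s ^ 3) * (x i)\<^sup>2 + \<nu> * ((rad s)\<^sup>2 * (w i \<bullet> w i))"
      unfolding kruskal_metric_levi_civita[OF M_pos K T[OF i]]
      by (simp only: s(1) koszul_form_normal[OF s(2)] \<nu>_def)
  qed simp
  also have "\<dots> = H + 16 * H * M ^ 3 / rad s ^ 3 + 2 * \<nu>"
  proof -
    have "(\<Sum>i=1..3. (H + 16 * H * M ^ 3 / rad s ^ 3) * (x i)\<^sup>2 + \<nu> * ((rad s)\<^sup>2 * (w i \<bullet> w i))) =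
        (H + 16 * H * M ^ 3 / rad s ^ 3) * (\<Sum>i=1..3. (x i)\<^sup>2) + \<nu> * (\<Sum>i=1..3. (rad s)\<^sup>2 * (w i \<bullet> w i))"
      by (simp only: sum.distrib sum_distrib_left)
    then show ?thesis unfolding sums by simp
  qed
  \<comment> \<open>Since s^2 pol = r^3 - 8M^3, twice \<open>\<nu>\<close> is 2H - 16HM^3/r^3, which
    cancels the M^3 term of the radial curvature.\<close>
  also have "\<dots> = 3 * H"
  proof -
    have s2: "s\<^sup>2 = rad s - 2 * M" by (simp add: rad_def)
    have "H * s\<^sup>2 * pol s = H * rad s ^ 3 - 8 * H * M ^ 3"
      unfolding s2 pol_def by (simp add: algebra_simps power2_eq_square power3_eq_cube)
    then show ?thesis using rad_pos[of s] unfolding \<nu>_def by (simp add: field_simps)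
  qed
  finally show "1 / 3 * (\<Sum>i=1..3. kruskal_metric M p
      (levi_civita (kruskal M) (kruskal_metric M) p (e i) normal) (e i)) = H"
    by simp
qed simp_all

subsection \<open>Global structure\<close>

lemma smooth_hypersurface_surface: "smooth_hypersurface (kruskal M) surface"
  unfolding smooth_hypersurface_def
proof (intro conjI ballI surface_subset exI[of _ UNIV] exI[of _ defining] smooth_defining)
  show "surface \<inter> UNIV = {q \<in> kruskal M \<inter> UNIV. defining q = 0}"
    using surface_eq by simp
  fix q assume "q \<in> surface \<inter> UNIV"
  then have K: "q \<in> kruskal M" and "q \<in> surface" using surface_subset by auto
  then obtain s \<omega> where q: "q = (U s, V s, \<omega>)" by (auto simp: surface_def)
  show "\<exists>v\<in>tangent_space (kruskal M) q. frechet_derivative defining (at q) v \<noteq> 0"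
  \<comment> \<open>The witness is the direction of T: X is constant along it, so
    \<open>defining\<close> changes at rate 1.\<close>
  proof (rule bexI[of _ "(-1, 1, 0)"])
    show "(-1, 1, 0) \<in> tangent_space (kruskal M) q"
      using K tangent_space_kruskal by (simp add: q)
    show "frechet_derivative defining (at q) (-1, 1, 0) \<noteq> 0"
      using fun_cong[OF frechet_derivative_at[OF defining_deriv[of s \<omega>]], of "(-1, 1, 0)"] q by simp
  qed
qed simp_all

lemma complete_hypersurface_surface: "complete_hypersurface (kruskal M) surface"
  unfolding complete_hypersurface_def
proof (intro conjI smooth_hypersurface_surface)
  have "continuous_on UNIV defining"
    using smooth_defining by (auto simp: smooth_on_def dest: spec[of _ 0])
  from continuous_closedin_preimage_constant[OF continuous_on_subset[OF this subset_UNIV]]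
  show "closedin (top_of_set (kruskal M)) surface"
    unfolding surface_eq .
qed

lemma ss_cmc_surface: "ss_cmc M H surface"
  unfolding ss_cmc_def
proof (intro conjI ballI smooth_hypersurface_surface spacelike_surface has_mean_curvature_surface)
  show "spherically_symmetric surface"
    by (auto simp: spherically_symmetric_def surface_def rotation_matrix_def
        norm_orthogonal_matrix_vector_mult)
qed

section \<open>Pieces of the surface and its two ends\<close>

definition part :: "real set \<Rightarrow> event set" where
  "part I = {(U s, V s, \<omega>) | s \<omega>. s \<in> I \<and> norm \<omega> = 1}"

lemma continuous_U: "continuous_on A U" and continuous_V: "continuous_on A V"
  using U_deriv V_deriv by (auto intro!: continuous_at_imp_continuous_on DERIV_isCont)

lemma part_image: "part I = (\<lambda>(s, \<omega>). (U s, V s, \<omega>)) ` (I \<times> sphere 0 1)"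
  by (auto simp: part_def image_iff)

lemma continuous_part: "continuous_on A (\<lambda>(s, \<omega>). (U s, V s, \<omega> :: real ^ 3))"
  unfolding split_beta
  by (intro continuous_intros continuous_on_compose2[OF continuous_U[of UNIV]]
      continuous_on_compose2[OF continuous_V[of UNIV]]) auto

lemma connected_part: "connected I \<Longrightarrow> connected (part I)"
  unfolding part_image
  by (intro connected_continuous_image continuous_part connected_Times connected_sphere) simp_all

lemma compact_part: "compact I \<Longrightarrow> compact (part I)"
  unfolding part_image
  by (intro compact_continuous_image continuous_part compact_Times) simp_all

lemma surface_part: "surface = part UNIV"
  by (simp add: surface_def part_def)

text \<open>The parameter s of a point of the surface, extended to all events. It is proper on the
  surface, and its sign tells the two ends apart.\<close>

definition coord :: "event \<Rightarrow> real" where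
  "coord q = par ((fst q + fst (snd q)) / 2)"

lemma part_coord: "{q \<in> surface. coord q \<in> I} = part I"
proof -
  have "coord (U s, V s, \<omega>) = s" for s \<omega>
    by (simp add: coord_def X_def[symmetric] par_X)
  then show ?thesis by (auto simp: surface_def part_def)
qed

lemma card_ends_surface: "card (topological_ends surface) = 2"
proof (rule card_topological_ends_eq_2[where f = coord])
  have "continuous_on UNIV par"
    using par_deriv by (auto intro!: continuous_at_imp_continuous_on DERIV_isCont)
  moreover have "continuous_on surface (\<lambda>q. (fst q + fst (snd q)) / 2)"
    by (intro continuous_intros) simp
  ultimately show "continuous_on surface coord"
    unfolding coord_def[abs_def] by (rule continuous_on_compose2) simp
  show "compact {q \<in> surface. \<bar>coord q\<bar> \<le> R}" for R
  proof -
    have "{q \<in> surface. \<bar>coord q\<bar> \<le> R} = part {- R..R}"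
      unfolding part_coord[symmetric] by auto
    then show ?thesis using compact_part[of "{- R..R}"] by simp
  qed
  show "connected {q \<in> surface. \<sigma> * coord q > R}" if "\<sigma> \<in> {-1, 1}" for R \<sigma>
  proof -
    have "{s. \<sigma> * s > R} = {R<..} \<or> {s. \<sigma> * s > R} = {..<- R}" using that by auto
    then have "connected {s. \<sigma> * s > R}" by (metis connected_Ioi connected_Iio)
    then show ?thesis using connected_part part_coord[of "{s. \<sigma> * s > R}"] by simp
  qed
  show "\<exists>q\<in>surface. \<sigma> * coord q > R" if "\<sigma> \<in> {-1, 1}" for R \<sigma>
  proof -
    obtain \<omega> :: "real ^ 3" where "norm \<omega> = 1" using vector_choose_size[of 1] by auto
    moreover have "\<sigma> * (\<sigma> * (R + 1)) > R" using that by auto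
    ultimately have "(U (\<sigma> * (R + 1)), V (\<sigma> * (R + 1)), \<omega>) \<in> part {s. \<sigma> * s > R}"
      by (auto simp: part_def)
    then show ?thesis unfolding part_coord[symmetric] by blast
  qed
qed

section \<open>Identification of the two halves with the given hypersurfaces\<close>

lemma slope_minus: "slope (- s) = slope s"
  by (simp add: slope_def pol_def rad_def den_def disc_def num_def)

text \<open>The sign \<open>\<sigma>\<close> treats both regions at once, -1 turning
  \<open>l1\<close> into \<open>l3\<close>. As \<open>slope\<close> is even, the integrand is the
  derivative of F(\<open>\<sigma> * sqrt (x - 2 * M)\<close>), and the additive constant cancels its
  value at \<open>r\<^sub>0\<close>.\<close>

lemma height_eq:
  assumes \<sigma>: "\<sigma> \<in> {-1, 1}" and c: "c = - 8 * M ^ 3 * H" and r: "r\<^sub>0 > 2 * M" "r > 2 * M"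
  shows "height M (\<lambda>x. \<sigma> * l1 M H c x) r\<^sub>0 (F (\<sigma> * sqrt (r\<^sub>0 - 2 * M))) r = F (\<sigma> * sqrt (r - 2 * M))"
proof -
  let ?f = "\<lambda>x. \<sigma> * l1 M H c x / schwarzschild_h M x * (1 / sqrt (1 + (\<sigma> * l1 M H c x)\<^sup>2))"
  have f: "?f x = slope (\<sigma> * sqrt (x - 2 * M)) * (\<sigma> / (2 * sqrt (x - 2 * M)))" if "x > 2 * M" for x
  proof -
    have "\<sigma>\<^sup>2 = 1" using \<sigma> by auto
    then have "?f x = \<sigma> * (l1 M H c x / schwarzschild_h M x * (1 / sqrt (1 + (l1 M H c x)\<^sup>2)))"
      by (simp add: power_mult_distrib)
    also have "\<dots> = slope (\<sigma> * sqrt (x - 2 * M)) * (\<sigma> / (2 * sqrt (x - 2 * M)))"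
      unfolding l1_integrand[OF that c] using \<sigma> by (auto simp: slope_minus)
    finally show ?thesis .
  qed
  \<comment> \<open>The integral runs backwards when r < \<open>r\<^sub>0\<close>; either way the
    interval stays above the singularity at 2M.\<close>
  let ?I = "{min r\<^sub>0 r..max r\<^sub>0 r}"
  have I: "x > 2 * M" if "x \<in> ?I" for x using that r by auto
  have slope: "continuous_on UNIV slope"
    using smooth_slope by (auto simp: smooth_on_def dest: spec[of _ 0])
  have "continuous_on ?I (\<lambda>x. slope (\<sigma> * sqrt (x - 2 * M)) * (\<sigma> / (2 * sqrt (x - 2 * M))))"
    by (intro continuous_intros continuous_on_compose2[OF slope]) (auto dest: I)
  then have cont: "continuous_on ?I ?f"
    using f I by (subst continuous_on_cong[OF refl]) auto
  have deriv: "((\<lambda>x. F (\<sigma> * sqrt (x - 2 * M))) has_vector_derivative ?f x) (at x within ?I)"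
    if "min r\<^sub>0 r \<le> x" "x \<le> max r\<^sub>0 r" for x
  proof -
    have x: "x > 2 * M" using I that by simp
    then have "((\<lambda>x. \<sigma> * sqrt (x - 2 * M)) has_real_derivative \<sigma> / (2 * sqrt (x - 2 * M))) (at x)"
      by (auto intro!: derivative_eq_intros simp: field_simps)
    from DERIV_chain2[OF F_deriv this]
    show ?thesis unfolding f[OF x] has_real_derivative_iff_has_vector_derivative
      by (rule has_vector_derivative_at_within)
  qed
  show ?thesis
    unfolding height_def using interval_integral_FTC_finite[OF cont deriv] by simp
qed

text \<open>For the converse, t gives ln |b| - ln |a| and the radius equation gives ln |a| + ln |b|.
  These two linear equations recover |a| and |b|, and \<open>\<sigma>\<close> restores the
  signs.\<close>

lemma part_eq:
  assumes \<sigma>: "\<sigma> \<in> {-1, 1}"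
  shows "(a, b, \<omega>) \<in> part {s. \<sigma> * s > 0} \<longleftrightarrow> (a, b, \<omega>) \<in> kruskal M \<and> \<sigma> * a > 0 \<and> \<sigma> * b > 0 \<and>
    schwarzschild_t M a b = F (\<sigma> * sqrt (radius M a b - 2 * M))" (is "?L \<longleftrightarrow> ?R")
proof
  assume ?L
  then obtain s where s: "a = U s" "b = V s" "\<sigma> * s > 0" "norm \<omega> = 1" by (auto simp: part_def)
  have "(a, b, \<omega>) \<in> kruskal M" using s surface_subset by (auto simp: surface_def)
  moreover have "\<sigma> * a > 0" "\<sigma> * b > 0"
    using s(3) by (simp_all add: s U_def V_def mult.assoc[symmetric])
  moreover have "\<sigma> * sqrt (radius M a b - 2 * M) = s"
    using \<sigma> s(3) by (auto simp: s(1,2) radius_UV rad_def)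
  moreover have "schwarzschild_t M a b = F s"
  proof -
    have "V s / U s = exp (F s / (2 * M))"
      using s(3) M_pos by (auto simp: U_def V_def exp_add exp_diff field_simps simp flip: exp_add)
    then show ?thesis using M_pos by (simp add: schwarzschild_t_def s(1,2))
  qed
  ultimately show ?R by simp
next
  assume ?R
  then have K: "a * b > - 2 * M" "norm \<omega> = 1" and ab: "\<sigma> * a > 0" "\<sigma> * b > 0"
    and t: "schwarzschild_t M a b = F (\<sigma> * sqrt (radius M a b - 2 * M))"
    by (auto simp: kruskal_def)
  define r where "r = radius M a b"
  define s where "s = \<sigma> * sqrt (r - 2 * M)"
  have pos: "a * b > 0" using ab \<sigma> by (auto simp: zero_less_mult_iff)
  have r: "r > 2 * M" "(r - 2 * M) * exp (r / (2 * M)) = a * b"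
    using radius_gt[OF M_pos pos] radius_eq[OF M_pos K(1)] by (simp_all add: r_def)
  have s: "\<sigma> * s > 0" "s\<^sup>2 = r - 2 * M" "rad s = r" "\<bar>s\<bar> = \<sigma> * s"
    using \<sigma> r(1) by (auto simp: s_def rad_def)
  have nz: "a \<noteq> 0" "b \<noteq> 0" using pos by auto
  have "2 * M * (ln \<bar>b\<bar> - ln \<bar>a\<bar>) = F s"
    using t nz by (simp add: schwarzschild_t_def s_def r_def abs_divide ln_div)
  then have diff: "ln \<bar>b\<bar> - ln \<bar>a\<bar> = 2 * (F s / (4 * M))"
    using M_pos by (simp add: field_simps)
  have "\<bar>a\<bar> * \<bar>b\<bar> = \<bar>s\<bar>\<^sup>2 * exp (r / (2 * M))"
    using r(2) pos by (simp add: s(2) abs_mult[symmetric])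
  moreover have "ln \<bar>a\<bar> + ln \<bar>b\<bar> = ln (\<bar>a\<bar> * \<bar>b\<bar>)"
    using nz by (intro ln_mult_pos[symmetric]) auto
  ultimately have "ln \<bar>a\<bar> + ln \<bar>b\<bar> = ln (\<bar>s\<bar>\<^sup>2 * exp (r / (2 * M)))" by simp
  also have "\<dots> = ln (\<bar>s\<bar>\<^sup>2) + r / (2 * M)"
    using s(1) by (subst ln_mult_pos) auto
  also have "ln (\<bar>s\<bar>\<^sup>2) = 2 * ln \<bar>s\<bar>"
    using s(1) by (subst ln_realpow) auto
  also have "r / (2 * M) = 2 * (r / (4 * M))" by simp
  finally have sum: "ln \<bar>a\<bar> + ln \<bar>b\<bar> = 2 * ln \<bar>s\<bar> + 2 * (r / (4 * M))" .
  have "\<bar>a\<bar> = exp (ln \<bar>s\<bar> + (r / (4 * M) - F s / (4 * M)))"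
    using diff sum nz by (subst exp_ln[of "\<bar>a\<bar>", symmetric]) (auto simp del: exp_ln)
  then have "\<bar>a\<bar> = \<bar>s\<bar> * exp (r / (4 * M) - F s / (4 * M))"
    using s(1) by (subst (asm) exp_add) auto
  moreover have "\<bar>b\<bar> = exp (ln \<bar>s\<bar> + (r / (4 * M) + F s / (4 * M)))"
    using diff sum nz by (subst exp_ln[of "\<bar>b\<bar>", symmetric]) (auto simp del: exp_ln)
  then have "\<bar>b\<bar> = \<bar>s\<bar> * exp (r / (4 * M) + F s / (4 * M))"
    using s(1) by (subst (asm) exp_add) auto
  moreover have "\<bar>a\<bar> = \<sigma> * a" "\<bar>b\<bar> = \<sigma> * b" using \<sigma> ab by auto
  ultimately have "\<sigma> * a = \<sigma> * U s" "\<sigma> * b = \<sigma> * V s"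
    by (simp_all add: U_def V_def s(3,4))
  then have "a = U s" "b = V s" using \<sigma> by auto
  then show ?L using s(1) K(2) by (auto simp: part_def)
qed

lemma Sigma_eq_part:
  assumes c: "c = - 8 * M ^ 3 * H" and r: "r\<^sub>0 > 2 * M"
  shows Sigma1_eq_part: "Sigma1 M H c r\<^sub>0 (F (sqrt (r\<^sub>0 - 2 * M))) = part {0<..}"
    and Sigma3_eq_part: "Sigma3 M H c r\<^sub>0 (F (- sqrt (r\<^sub>0 - 2 * M))) = part {..<0}"
proof -
  have eq: "height M (\<lambda>x. \<sigma> * l1 M H c x) r\<^sub>0 (F (\<sigma> * sqrt (r\<^sub>0 - 2 * M))) (radius M a b) =
      F (\<sigma> * sqrt (radius M a b - 2 * M))" if "\<sigma> \<in> {-1, 1}" "a * b > 0" for \<sigma> a b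
    using height_eq[OF that(1) c r radius_gt[OF M_pos that(2)]] .
  have "(a, b, \<omega>) \<in> Sigma1 M H c r\<^sub>0 (F (sqrt (r\<^sub>0 - 2 * M))) \<longleftrightarrow> (a, b, \<omega>) \<in> part {s. 1 * s > 0}" for a b \<omega>
    using eq[of 1 a b] by (subst part_eq) (auto simp: Sigma1_def)
  then show "Sigma1 M H c r\<^sub>0 (F (sqrt (r\<^sub>0 - 2 * M))) = part {0<..}"
    by (auto simp: greaterThan_def)
  have "(a, b, \<omega>) \<in> Sigma3 M H c r\<^sub>0 (F (- sqrt (r\<^sub>0 - 2 * M))) \<longleftrightarrow> (a, b, \<omega>) \<in> part {s. - 1 * s > 0}" for a b \<omega>
    using eq[of "-1" a b] by (subst part_eq) (auto simp: Sigma3_def l3_def[abs_def] mult_neg_neg)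
  then show "Sigma3 M H c r\<^sub>0 (F (- sqrt (r\<^sub>0 - 2 * M))) = part {..<0}"
    by (auto simp: lessThan_def)
qed

lemma bifurcation_eq_part: "bifurcation_sphere M = part {0}"
  using M_pos by (auto simp: bifurcation_sphere_def part_def kruskal_def U_def V_def)

lemma part_union: "part {0<..} \<union> part {0} \<union> part {..<0} = surface"
proof -
  have "part I \<union> part J = part (I \<union> J)" for I J by (auto simp: part_def)
  moreover have "{0<..} \<union> {0} \<union> {..<0} = (UNIV :: real set)" by auto
  ultimately show ?thesis by (simp add: surface_part)
qed

text \<open>The closures lie in the opposite closed quadrants of the (U, V) plane, which meet only
  at the origin; conversely, the bifurcation sphere is reached by letting s tend to 0 from either
  side.\<close>

lemma closure_parts: "kruskal M \<inter> closure (part {0<..}) \<inter> closure (part {..<0}) = part {0}"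
proof (intro equalityI subsetI)
  fix q assume q: "q \<in> kruskal M \<inter> closure (part {0<..}) \<inter> closure (part {..<0})"
  have "closure (part {0<..}) \<subseteq> {q. 0 \<le> fst q \<and> 0 \<le> fst (snd q)}"
    by (intro closure_minimal closed_Collect_conj closed_Collect_le continuous_intros)
      (auto simp: part_def U_def V_def)
  moreover have "closure (part {..<0}) \<subseteq> {q. fst q \<le> 0 \<and> fst (snd q) \<le> 0}"
    by (intro closure_minimal closed_Collect_conj closed_Collect_le continuous_intros)
      (auto simp: part_def U_def V_def mult_nonpos_nonneg)
  ultimately have "fst q = 0" "fst (snd q) = 0" using q by fastforce+
  then show "q \<in> part {0}"
    using q by (cases q) (auto simp: bifurcation_eq_part[symmetric] bifurcation_sphere_def)
next
  fix q assume "q \<in> part {0}"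
  then obtain \<omega> where q: "q = (U 0, V 0, \<omega>)" "norm \<omega> = 1" by (auto simp: part_def)
  have "(U 0, V 0, \<omega>) \<in> closure (part I)" if "0 \<in> closure I" for I
  proof -
    have "(\<lambda>s. (U s, V s, \<omega>)) ` closure I \<subseteq> closure (part I)"
    proof (rule image_closure_subset)
      show "continuous_on (closure I) (\<lambda>s. (U s, V s, \<omega>))"
        by (intro continuous_intros continuous_U continuous_V)
      show "(\<lambda>s. (U s, V s, \<omega>)) ` I \<subseteq> closure (part I)"
        using q(2) by (intro subset_trans[OF _ closure_subset]) (auto simp: part_def)
    qed simp
    then show ?thesis using that by blast
  qed
  moreover have "q \<in> kruskal M" using q surface_subset by (auto simp: surface_def)
  ultimately show "q \<in> kruskal M \<inter> closure (part {0<..}) \<inter> closure (part {..<0})"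
    using q by simp
qed

end

theorem theorem5:
  fixes M H c\<^sub>1 r\<^sub>1 r\<^sub>3 cbar\<^sub>1 :: real
  assumes "M > 0" and "r\<^sub>1 > 2 * M" and "r\<^sub>3 > 2 * M"
    and "c\<^sub>1 = - 8 * M ^ 3 * H"
  shows "\<exists>cbar\<^sub>3 :: real.
    let S1 = Sigma1 M H c\<^sub>1 r\<^sub>1 cbar\<^sub>1;
        S3 = Sigma3 M H c\<^sub>1 r\<^sub>3 cbar\<^sub>3;
        S = S1 \<union> bifurcation_sphere M \<union> S3
    in kruskal M \<inter> closure S1 \<inter> closure S3 = bifurcation_sphere M \<and>
       complete_hypersurface (kruskal M) S \<and>
       ss_cmc M H S \<and>
       connected S \<and>
       card (topological_ends S) = 2"
proof -
  interpret schwarzschild M H by unfold_locales (fact assms(1))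
  \<comment> \<open>The additive constant of the antiderivative is spent on matching the prescribed
    \<open>cbar\<^sub>1\<close> at \<open>r\<^sub>1\<close>.\<close>
  obtain F where F: "\<And>s. (F has_real_derivative slope s) (at s)" "F (sqrt (r\<^sub>1 - 2 * M)) = cbar\<^sub>1"
    using slope_antiderivative by blast
  interpret glued_curve M H F by unfold_locales (fact F(1))
  show ?thesis
  \<comment> \<open>The witness is the value of the same F at the parameter of
    \<open>r\<^sub>3\<close> in region I', the negative root of s^2 = \<open>r\<^sub>3\<close> -
    2M.\<close>
  proof (rule exI[of _ "F (- sqrt (r\<^sub>3 - 2 * M))"])
    show "let S1 = Sigma1 M H c\<^sub>1 r\<^sub>1 cbar\<^sub>1;
        S3 = Sigma3 M H c\<^sub>1 r\<^sub>3 (F (- sqrt (r\<^sub>3 - 2 * M)));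
        S = S1 \<union> bifurcation_sphere M \<union> S3
      in kruskal M \<inter> closure S1 \<inter> closure S3 = bifurcation_sphere M \<and>
        complete_hypersurface (kruskal M) S \<and> ss_cmc M H S \<and> connected S \<and> card (topological_ends S) = 2"
      using Sigma1_eq_part[OF assms(4,2)] Sigma3_eq_part[OF assms(4,3)] connected_part[of UNIV]
      by (simp add: Let_def F(2) bifurcation_eq_part part_union closure_parts complete_hypersurface_surface
          ss_cmc_surface card_ends_surface surface_part[symmetric])
  qed
qed

end
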